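(* Let $E\subset[0,1]^2$ be a compact set with $\mathcal{H}^1(E)<\infty$, and assume that $E$ is purely unrectifiable. If $\mathcal{C}\subset\mathbb{R}^2$ is a piecewise $C^1$ curve of finite length with a piecewise bilipschitz continuous unit tangent vector, then $\mathrm{Fav}_{\mathcal{C}}(E)=0$.
   Context: $|\cdot|$ denotes Lebesgue measure and $\mathcal{H}^1$ is $1$-dimensional Hausdorff measure. $E$ is purely ($1$-)unrectifiable if $\mathcal{H}^1(E\cap f(\mathbb{R}))=0$ for every Lipschitz function $f:\mathbb{R}\to\mathbb{R}^2$. Curve: $\mathcal{C}$ is a finite concatenation of $C^1$ arcs of finite length such that on each arc, parametrized by arclength as $\gamma$, the unit tangent is bilipschitz: there is $\Lambda\ge1$ with $\Lambda^{-1}|s-t|\le|\gamma'(s)-\gamma'(t)|\le\Lambda|s-t|$. Such a curve is a finite union of pieces of the form $\{t\omega_1+\varphi(t)\omega_2:t\in I\}$ with $(\omega_1,\omega_2)$ orthonormal, $I$ a bounded interval, $\varphi$ of class $C^1$ and $\varphi'$ bilipschitz. Favard curve length: $\mathrm{Fav}_{\mathcal{C}}(E)=\left|\{(\alpha,\beta)\in\mathbb{R}^2:\ ((\alpha,\beta)+\mathcal{C})\cap E\neq\emptyset\}\right|$. *)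

theory Defs
  imports "HOL-Analysis.Analysis"
begin

text \<open>
  The plane is the type \<^typ>\<open>real \<times> real\<close>, whose norm and distance are the Euclidean ones.
\<close>

section \<open>One-dimensional Hausdorff measure\<close>

text \<open>
  \<^const>\<open>diameter\<close> is real-valued and only meaningful for bounded sets, hence the explicit
  boundedness of the covering sets. Finite covers are included, since covering sets may be empty.
  If there is no admissible cover, the infimum is \<^term>\<open>\<infinity> :: ennreal\<close>.
\<close>

definition hausdorff1_pre :: "real \<Rightarrow> 'a::metric_space set \<Rightarrow> ennreal" where
  "hausdorff1_pre \<delta> A =
     Inf {(\<Sum>i. ennreal (diameter (U i))) | U :: nat \<Rightarrow> 'a set.
            A \<subseteq> (\<Union>i. U i) \<and> (\<forall>i. bounded (U i) \<and> diameter (U i) \<le> \<delta>)}"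

definition hausdorff1 :: "'a::metric_space set \<Rightarrow> ennreal" where
  "hausdorff1 A = (SUP \<delta>\<in>{0<..}. hausdorff1_pre \<delta> A)"

definition purely_unrectifiable :: "(real \<times> real) set \<Rightarrow> bool" where
  "purely_unrectifiable E \<longleftrightarrow>
     (\<forall>f :: real \<Rightarrow> real \<times> real. (\<exists>L. L-lipschitz_on UNIV f) \<longrightarrow> hausdorff1 (E \<inter> range f) = 0)"

section \<open>Curves with piecewise bilipschitz unit tangent\<close>

text \<open>
  A \<open>C\<^sup>1\<close> arc of finite length \<open>b - a\<close>, parametrized by arclength on \<open>[a, b]\<close>, with bilipschitz
  unit tangent \<open>\<gamma>'\<close>; derivatives at the two endpoints are one-sided.
\<close>

definition bilipschitz_tangent_arc :: "(real \<Rightarrow> real \<times> real) \<Rightarrow> real \<Rightarrow> real \<Rightarrow> bool" where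
  "bilipschitz_tangent_arc \<gamma> a b \<longleftrightarrow> a < b \<and>
     (\<exists>\<gamma>'. (\<forall>s\<in>{a..b}. (\<gamma> has_vector_derivative \<gamma>' s) (at s within {a..b})) \<and>
           continuous_on {a..b} \<gamma>' \<and>
           (\<forall>s\<in>{a..b}. norm (\<gamma>' s) = 1) \<and>
           (\<exists>\<Lambda>\<ge>1. \<forall>s\<in>{a..b}. \<forall>t\<in>{a..b}.
              inverse \<Lambda> * \<bar>s - t\<bar> \<le> norm (\<gamma>' s - \<gamma>' t) \<and>
              norm (\<gamma>' s - \<gamma>' t) \<le> \<Lambda> * \<bar>s - t\<bar>))"

text \<open>
  The arcs are joined end to end at the breakpoints \<open>\<tau> 0 < \<dots> < \<tau> n\<close>. At an interior breakpoint
  \<open>\<gamma>\<close> is continuous, but its two one-sided derivatives may differ.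
\<close>

definition piecewise_bilipschitz_tangent_curve :: "(real \<times> real) set \<Rightarrow> bool" where
  "piecewise_bilipschitz_tangent_curve C \<longleftrightarrow>
     (\<exists>(n::nat) (\<tau> :: nat \<Rightarrow> real) \<gamma>.
        0 < n \<and> (\<forall>i<n. bilipschitz_tangent_arc \<gamma> (\<tau> i) (\<tau> (Suc i))) \<and>
        C = (\<Union>i<n. \<gamma> ` {\<tau> i..\<tau> (Suc i)}))"

section \<open>Favard curve length\<close>

definition favard_set :: "(real \<times> real) set \<Rightarrow> (real \<times> real) set \<Rightarrow> (real \<times> real) set" where
  "favard_set C E = {(\<alpha>, \<beta>). (\<lambda>c. (\<alpha>, \<beta>) + c) ` C \<inter> E \<noteq> {}}"

definition favard_curve_length :: "(real \<times> real) set \<Rightarrow> (real \<times> real) set \<Rightarrow> ennreal" where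
  "favard_curve_length C E = emeasure lebesgue (favard_set C E)"

text \<open>
  \<^const>\<open>emeasure\<close> is \<open>0\<close> by convention on non-measurable sets. The following lemmas show that
  this convention plays no role for compact sets and the curves above.
\<close>

lemma piecewise_bilipschitz_tangent_curve_compact:
  assumes "piecewise_bilipschitz_tangent_curve C"
  shows "compact C"
proof -
  obtain n :: nat and \<tau> :: "nat \<Rightarrow> real" and \<gamma>
    where arc: "\<And>i. i < n \<Longrightarrow> bilipschitz_tangent_arc \<gamma> (\<tau> i) (\<tau> (Suc i))"
      and C: "C = (\<Union>i<n. \<gamma> ` {\<tau> i..\<tau> (Suc i)})"
    using assms unfolding piecewise_bilipschitz_tangent_curve_def by blast
  have "continuous_on {\<tau> i..\<tau> (Suc i)} \<gamma>" if "i < n" for i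
    using arc[OF that] unfolding bilipschitz_tangent_arc_def
    by (meson continuous_on_eq_continuous_within has_vector_derivative_continuous)
  then show ?thesis
    unfolding C by (intro compact_UN compact_continuous_image) auto
qed

lemma favard_set_eq_differences: "favard_set C E = {e - c | e c. e \<in> E \<and> c \<in> C}"
proof (rule set_eqI)
  fix p :: "real \<times> real"
  have "p \<in> favard_set C E \<longleftrightarrow> (\<exists>c\<in>C. p + c \<in> E)"
    unfolding favard_set_def by (cases p) blast
  also have "\<dots> \<longleftrightarrow> (\<exists>e c. p = e - c \<and> e \<in> E \<and> c \<in> C)"
    by (metis add_diff_cancel_right' diff_add_cancel)
  finally show "p \<in> favard_set C E \<longleftrightarrow> p \<in> {e - c | e c. e \<in> E \<and> c \<in> C}"
    by simp
qed

lemma favard_set_compact: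
  assumes "compact E" "piecewise_bilipschitz_tangent_curve C"
  shows "compact (favard_set C E)"
  unfolding favard_set_eq_differences
  using compact_differences[OF assms(1) piecewise_bilipschitz_tangent_curve_compact[OF assms(2)]]
  by simp

end

theory Submission
  imports Defs
begin

text \<open>
  The Favard set is \<open>E - C\<close>. A short arc of \<open>C\<close> is, up to exchanging the two coordinates, part of a
  graph \<open>y = \<phi> x\<close> whose slope \<open>\<psi> = \<phi>'\<close> is bilipschitz and monotone, and \<open>\<phi>\<close> extends to the whole line with
  these properties. The slice of \<open>E - C\<close> over \<open>\<alpha>\<close> is then contained in the image of \<open>E\<close> under the
  curved projection \<open>\<Phi> \<alpha> (x, y) = y - \<phi> (x - \<alpha>)\<close>, whose level sets are the translates of the graph.
  By Fubini it is enough to show that \<open>\<Phi> \<alpha> ` E\<close> is null for almost every \<open>\<alpha>\<close>: this is a nonlinear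
  version of the Besicovitch projection theorem (\<open>AE_negligible_image\<close> below). What replaces the
  rotation of the direction is transversality: for points \<open>e, e'\<close> with first coordinates \<open>x \<noteq> x'\<close>
  there is exactly one parameter \<open>a\<close> for which a translate of the graph joins them, and
  \<open>\<bar>\<Phi> \<alpha> e' - \<Phi> \<alpha> e\<bar>\<close> is comparable to \<open>\<bar>x' - x\<bar> \<bar>\<alpha> - a\<bar>\<close>. So \<open>a\<close> plays the role of the angle under which
  \<open>e'\<close> is seen from \<open>e\<close>.

  The proof of the projection theorem follows Besicovitch. Let \<open>\<mu>\<close> be the length measure on \<open>E\<close>. Almost
  every fibre of \<open>\<Phi> \<alpha>\<close> on \<open>E\<close> is finite (\<open>negligible_infinite_fibres\<close>), so after intersecting \<open>E\<close>
  with small closed sets only those \<open>e\<close> matter that are alone in their fibre. For such \<open>e\<close> the size of the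
  curved sectors \<open>{e'. \<bar>x' - x\<bar> < r, \<bar>\<Phi> \<alpha> e' - \<Phi> \<alpha> e\<bar> < s \<bar>x' - x\<bar>}\<close>, compared with \<open>r s\<close>, decides.

  If the ratio \<open>\<mu>(sector) / (r s)\<close> is unbounded, then the projection of \<open>\<mu>\<close> to the line has infinite maximal
  density at \<open>\<Phi> \<alpha> e\<close>, and this happens only on a null set of values (\<open>negligible_thick_image\<close>).

  If the ratio tends to \<open>0\<close> as \<open>s \<longlonglongrightarrow> 0\<close>, uniformly in \<open>r\<close>, then \<open>e\<close> belongs to a set that is \<open>\<mu>\<close>-null for
  every \<open>\<alpha>\<close> (\<open>thin_null\<close>): a set with small sectors is, apart from a part that lies on a Lipschitz graph,
  covered by strips of small total measure, and a Lipschitz graph carries no mass because \<open>E\<close> is purely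
  unrectifiable.

  For fixed \<open>e\<close>, almost no parameter \<open>\<alpha>\<close> escapes this alternative (\<open>dichotomy\<close>). The ratio is bounded
  on a compact set of exceptional parameters, and no point of \<open>E\<close> is seen from \<open>e\<close> under a parameter of this
  set. All mass of a sector is therefore seen under parameters in the gaps of the set, so a ratio bounded below
  forces gaps of proportional size at arbitrarily small scales, which a set of positive measure cannot have.
  Fubini turns "for every \<open>e\<close>, almost every \<open>\<alpha>\<close>" into "for almost every \<open>\<alpha>\<close>, \<open>\<mu>\<close>-almost every \<open>e\<close>", and
  \<open>\<Phi> \<alpha>\<close>, being Lipschitz on \<open>E\<close>, maps \<open>\<mu>\<close>-null parts of \<open>E\<close> to null sets.
\<close>

section \<open>One-dimensional Hausdorff measure as a Borel measure\<close>

lemma hausdorff1_pre_le: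
  assumes "A \<subseteq> (\<Union>i. U i)" "\<And>i. bounded (U i)" "\<And>i. diameter (U i) \<le> \<delta>"
  shows "hausdorff1_pre \<delta> A \<le> (\<Sum>i. ennreal (diameter (U i)))"
  unfolding hausdorff1_pre_def by (intro Inf_lower) (use assms in auto)

lemma hausdorff1_pre_cover:
  assumes "hausdorff1_pre \<delta> A < e"
  obtains U where "A \<subseteq> (\<Union>i. U i)" "\<And>i. bounded (U i)" "\<And>i. diameter (U i) \<le> \<delta>"
    "(\<Sum>i. ennreal (diameter (U i))) < e"
  using assms that unfolding hausdorff1_pre_def Inf_less_iff by auto

lemma hausdorff1_pre_le_hausdorff1: "0 < \<delta> \<Longrightarrow> hausdorff1_pre \<delta> A \<le> hausdorff1 A"
  unfolding hausdorff1_def by (auto intro!: SUP_upper)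

lemma hausdorff1_pre_mono: "A \<subseteq> B \<Longrightarrow> hausdorff1_pre \<delta> A \<le> hausdorff1_pre \<delta> B"
  unfolding hausdorff1_pre_def by (intro Inf_superset_mono) auto

lemma hausdorff1_pre_antimono: "\<delta> \<le> \<delta>' \<Longrightarrow> hausdorff1_pre \<delta>' A \<le> hausdorff1_pre \<delta> A"
  unfolding hausdorff1_pre_def by (intro Inf_superset_mono) (blast intro: order_trans)

lemma hausdorff1_mono: "A \<subseteq> B \<Longrightarrow> hausdorff1 A \<le> hausdorff1 B"
  unfolding hausdorff1_def by (intro SUP_mono) (auto intro: hausdorff1_pre_mono)

lemma hausdorff1_empty [simp]: "hausdorff1 {} = 0"
proof -
  have "hausdorff1_pre \<delta> ({} :: 'a set) \<le> 0" if "0 < \<delta>" for \<delta>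
    using hausdorff1_pre_le[of "{}" "\<lambda>_. {}" \<delta>] that by auto
  then show ?thesis unfolding hausdorff1_def
    by (metis SUP_least bot.extremum_uniqueI bot_ennreal greaterThan_iff)
qed

lemma hausdorff1_pre_subadditive:
  "hausdorff1_pre \<delta> (\<Union>n. A n) \<le> (\<Sum>n. hausdorff1_pre \<delta> (A n))"
proof (rule ennreal_le_epsilon)
  fix e :: real assume "0 < e" "(\<Sum>n. hausdorff1_pre \<delta> (A n)) < top"
  then have *: "\<And>n. hausdorff1_pre \<delta> (A n) < hausdorff1_pre \<delta> (A n) + e * (1/2)^Suc n"
    by (auto simp add: less_top dest!: ennreal_suminf_lessD)
  have "\<exists>U. A n \<subseteq> (\<Union>i. U i) \<and> (\<forall>i. bounded (U i)) \<and> (\<forall>i. diameter (U i) \<le> \<delta>) \<and>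
     (\<Sum>i. ennreal (diameter (U i))) \<le> hausdorff1_pre \<delta> (A n) + e * (1/2)^Suc n" for n
    by (rule hausdorff1_pre_cover[OF *[of n]]) (use less_imp_le in blast)
  then obtain B where B: "\<And>n. A n \<subseteq> (\<Union>i. B n i)" "\<And>n i. bounded (B n i)"
      "\<And>n i. diameter (B n i) \<le> \<delta>"
      and Ble: "\<And>n. (\<Sum>i. ennreal (diameter (B n i))) \<le> hausdorff1_pre \<delta> (A n) + e * (1/2)^Suc n"
    by metis
  define C where "C = case_prod B o prod_decode"
  have "(\<Union>i. A i) \<subseteq> (\<Union>i. C i)"
    using B(1) by (auto simp add: C_def subset_eq) (metis prod.case prod_encode_inverse)
  then have "hausdorff1_pre \<delta> (\<Union>i. A i) \<le> (\<Sum>i. ennreal (diameter (C i)))"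
    by (intro hausdorff1_pre_le) (auto simp: C_def B split: prod.split)
  also have "\<dots> = (\<Sum>i. (case_prod (\<lambda>n i. ennreal (diameter (B n i)))) (prod_decode i))"
    by (simp add: C_def case_prod_unfold)
  also have "\<dots> = (\<Sum>n. \<Sum>i. ennreal (diameter (B n i)))"
    using suminf_ennreal_2dimen[of "\<lambda>n. \<Sum>i. ennreal (diameter (B n i))" "case_prod (\<lambda>n i. ennreal (diameter (B n i)))"]
    by (simp add: comp_def)
  also have "\<dots> \<le> (\<Sum>n. hausdorff1_pre \<delta> (A n) + e * (1/2) ^ Suc n)"
    by (intro suminf_le allI Ble) auto
  also have "... = (\<Sum>n. hausdorff1_pre \<delta> (A n)) + (\<Sum>n. ennreal e * ennreal ((1/2) ^ Suc n))"
    using \<open>0 < e\<close> by (subst suminf_add[symmetric])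
                     (auto simp del: ennreal_suminf_cmult simp add: ennreal_mult[symmetric])
  also have "\<dots> = (\<Sum>n. hausdorff1_pre \<delta> (A n)) + e"
    unfolding ennreal_suminf_cmult
    by (subst suminf_ennreal_eq[OF zero_le_power power_half_series]) auto
  finally show "hausdorff1_pre \<delta> (\<Union>i. A i) \<le> (\<Sum>n. hausdorff1_pre \<delta> (A n)) + e" .
qed

lemma hausdorff1_subadditive: "hausdorff1 (\<Union>n. A n) \<le> (\<Sum>n. hausdorff1 (A n))"
  unfolding hausdorff1_def[of "\<Union>n. A n"]
proof (rule SUP_least)
  fix \<delta> :: real assume "\<delta> \<in> {0<..}"
  then show "hausdorff1_pre \<delta> (\<Union>n. A n) \<le> (\<Sum>n. hausdorff1 (A n))"
    by (intro order_trans[OF hausdorff1_pre_subadditive] suminf_le hausdorff1_pre_le_hausdorff1) auto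
qed

lemma outer_measure_space_hausdorff1: "outer_measure_space UNIV (\<lambda>A. hausdorff1 (A \<inter> E))"
proof -
  have "hausdorff1 ((\<Union>n. A n) \<inter> E) \<le> (\<Sum>n. hausdorff1 (A n \<inter> E))" for A :: "nat \<Rightarrow> 'a set"
    using hausdorff1_subadditive[of "\<lambda>n. A n \<inter> E"] by simp
  then show ?thesis
    unfolding outer_measure_space_def positive_def increasing_def countably_subadditive_def
    by (auto intro!: hausdorff1_mono)
qed

lemma hausdorff1_Un: "hausdorff1 (A \<union> B) \<le> hausdorff1 A + hausdorff1 B"
  using hausdorff1_subadditive[of "\<lambda>n::nat. if n = 0 then A else if n = 1 then B else {}"]
  by (subst (asm) suminf_finite[of "{0,1}"]) (auto simp: Un_commute split: if_splits)

text \<open>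
  A covering set of diameter less than \<open>d\<close> cannot meet both parts, so a fine cover of the union splits
  into covers of the two parts.
\<close>

lemma hausdorff1_separated:
  fixes A B :: "'a::metric_space set"
  assumes "0 < d" and sep: "\<And>x y. x \<in> A \<Longrightarrow> y \<in> B \<Longrightarrow> d \<le> dist x y"
  shows "hausdorff1 A + hausdorff1 B \<le> hausdorff1 (A \<union> B)"
proof -
  have key: "hausdorff1_pre \<delta> A + hausdorff1_pre \<delta> B \<le> hausdorff1 (A \<union> B)"
    if \<delta>: "0 < \<delta>" "\<delta> < d" for \<delta>
  proof -
    have "hausdorff1_pre \<delta> A + hausdorff1_pre \<delta> B \<le> hausdorff1_pre \<delta> (A \<union> B)"
      unfolding hausdorff1_pre_def[of \<delta> "A \<union> B"]
    proof (rule Inf_greatest, clarify)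
      fix U :: "nat \<Rightarrow> 'a set"
      assume cov: "A \<union> B \<subseteq> (\<Union>i. U i)" and U: "\<forall>i. bounded (U i) \<and> diameter (U i) \<le> \<delta>"
      have le: "diameter (U i \<inter> S) \<le> diameter (U i)" for i S
        using U by (intro diameter_subset) auto
      have "hausdorff1_pre \<delta> A \<le> (\<Sum>i. ennreal (diameter (U i \<inter> A)))"
        using cov U by (intro hausdorff1_pre_le) (auto intro: order_trans[OF le])
      moreover have "hausdorff1_pre \<delta> B \<le> (\<Sum>i. ennreal (diameter (U i \<inter> B)))"
        using cov U by (intro hausdorff1_pre_le) (auto intro: order_trans[OF le])
      moreover have "ennreal (diameter (U i \<inter> A)) + ennreal (diameter (U i \<inter> B)) \<le> ennreal (diameter (U i))" for i
      proof -
        have "U i \<inter> A = {} \<or> U i \<inter> B = {}"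
        proof (rule ccontr)
          assume "\<not> ?thesis"
          then obtain x y where "x \<in> U i" "x \<in> A" "y \<in> U i" "y \<in> B" by blast
          then show False
            using sep[of x y] diameter_bounded_bound[of "U i" x y] U \<delta>
            by (smt (verit, best))
        qed
        then show ?thesis using le[of i A] le[of i B] by (auto simp: ennreal_leI)
      qed
      then have "(\<Sum>i. ennreal (diameter (U i \<inter> A))) + (\<Sum>i. ennreal (diameter (U i \<inter> B))) \<le> (\<Sum>i. ennreal (diameter (U i)))"
        by (subst suminf_add) (auto intro!: suminf_le)
      ultimately show "hausdorff1_pre \<delta> A + hausdorff1_pre \<delta> B \<le> (\<Sum>i. ennreal (diameter (U i)))"
        by (meson add_mono order_trans)
    qed
    then show ?thesis using hausdorff1_pre_le_hausdorff1[OF \<delta>(1)] order_trans by blast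
  qed
  have "hausdorff1 A + hausdorff1 B = (SUP \<delta>\<in>{0<..}. hausdorff1_pre \<delta> A + hausdorff1 B)"
    unfolding hausdorff1_def[of A] by (subst ennreal_SUP_add_left) auto
  also have "\<dots> = (SUP \<delta>\<in>{0<..}. SUP \<delta>'\<in>{0<..}. hausdorff1_pre \<delta> A + hausdorff1_pre \<delta>' B)"
    unfolding hausdorff1_def[of B] by (subst ennreal_SUP_add_right) auto
  also have "\<dots> \<le> hausdorff1 (A \<union> B)"
  proof (intro SUP_least)
    fix \<delta> \<delta>' :: real assume "\<delta> \<in> {0<..}" "\<delta>' \<in> {0<..}"
    define m where "m = min (min \<delta> \<delta>') (d/2)"
    have "hausdorff1_pre \<delta> A + hausdorff1_pre \<delta>' B \<le> hausdorff1_pre m A + hausdorff1_pre m B"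
      by (intro add_mono hausdorff1_pre_antimono) (auto simp: m_def)
    also have "\<dots> \<le> hausdorff1 (A \<union> B)"
      using \<open>\<delta> \<in> {0<..}\<close> \<open>\<delta>' \<in> {0<..}\<close> \<open>0 < d\<close> by (intro key) (auto simp: m_def)
    finally show "hausdorff1_pre \<delta> A + hausdorff1_pre \<delta>' B \<le> hausdorff1 (A \<union> B)" .
  qed
  finally show ?thesis .
qed

text \<open>
  Layers of a 1-Lipschitz function that are separated by gaps are sets at positive distance.
\<close>

lemma hausdorff1_separated_sum:
  fixes R :: "nat \<Rightarrow> 'a::metric_space set" and f :: "'a \<Rightarrow> real"
  assumes lip: "\<And>x y. \<bar>f x - f y\<bar> \<le> dist x y"
    and hi: "\<And>k x. x \<in> R k \<Longrightarrow> f x \<le> b k"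
    and lo: "\<And>k x. x \<in> R k \<Longrightarrow> a k < f x"
    and gap: "\<And>k. b (Suc k) < a k" and dec: "decseq a"
    and S: "\<And>k. R k \<subseteq> S"
  shows "(\<Sum>k. hausdorff1 (R k)) \<le> hausdorff1 S"
proof (rule suminf_le_const[OF summableI])
  fix n
  have "(\<Sum>k<n. hausdorff1 (R k)) \<le> hausdorff1 (\<Union>k<n. R k)"
  proof (induction n)
    case (Suc n)
    show ?case
    proof (cases n)
      case (Suc m)
      have "hausdorff1 (\<Union>k<n. R k) + hausdorff1 (R n) \<le> hausdorff1 ((\<Union>k<n. R k) \<union> R n)"
      proof (rule hausdorff1_separated)
        show "0 < a m - b (Suc m)" using gap by simp
        fix x y assume "x \<in> (\<Union>k<n. R k)" and y: "y \<in> R n"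
        then obtain k where k: "k \<le> m" "x \<in> R k" using Suc by (auto simp: less_Suc_eq_le)
        have "a m \<le> a k" using dec k by (simp add: decseqD)
        then show "a m - b (Suc m) \<le> dist x y"
          using lo[OF k(2)] hi[OF y] lip[of x y] Suc by simp
      qed
      then show ?thesis using Suc.IH
        by (simp add: lessThan_Suc Un_commute add.commute) (meson add_left_mono order_trans)
    qed (simp add: lessThan_Suc)
  qed auto
  also have "\<dots> \<le> hausdorff1 S" using S by (intro hausdorff1_mono) auto
  finally show "(\<Sum>k<n. hausdorff1 (R k)) \<le> hausdorff1 S" .
qed

text \<open>
  This is the Caratheodory criterion for the sets \<open>{x. f x \<le> c}\<close>. The part where \<open>f\<close> exceeds \<open>c\<close> by a
  fixed amount is at positive distance from the sublevel set. What is left is a tail of the layers \<open>R k\<close>. Every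
  other layer is separated from the next, so their measures have a finite sum and the tails tend to \<open>0\<close>.
\<close>

lemma hausdorff1_split_sublevel:
  fixes f :: "'a::metric_space \<Rightarrow> real"
  assumes lip: "\<And>x y. \<bar>f x - f y\<bar> \<le> dist x y" and fin: "hausdorff1 S < \<infinity>"
  shows "hausdorff1 (S \<inter> {x. f x \<le> c}) + hausdorff1 (S \<inter> {x. c < f x}) \<le> hausdorff1 S"
proof -
  define R where "R k = S \<inter> {x. c + inverse (real (Suc (Suc k))) < f x \<and> f x \<le> c + inverse (real (Suc k))}" for k
  define T where "T n = S \<inter> {x. c + inverse (real (Suc n)) < f x}" for n
  \<comment> \<open>The even and the odd layers are treated separately, since neighbouring layers touch.\<close>
  have "(\<Sum>k. hausdorff1 (R (2*k))) \<le> hausdorff1 S"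
    by (rule hausdorff1_separated_sum[of f _ "\<lambda>k. c + inverse (real (Suc (2*k)))" "\<lambda>k. c + inverse (real (Suc (Suc (2*k))))"])
       (auto simp: lip R_def decseq_def intro!: le_imp_inverse_le)
  moreover have "(\<Sum>k. hausdorff1 (R (2*k+1))) \<le> hausdorff1 S"
    by (rule hausdorff1_separated_sum[of f _ "\<lambda>k. c + inverse (real (Suc (2*k+1)))" "\<lambda>k. c + inverse (real (Suc (Suc (2*k+1))))"])
       (auto simp: lip R_def decseq_def intro!: le_imp_inverse_le)
  ultimately have "(\<Sum>k. hausdorff1 (R (2*k)) + hausdorff1 (R (2*k+1))) \<le> hausdorff1 S + hausdorff1 S"
    by (subst suminf_add[symmetric]) (auto intro!: add_mono)
  moreover have "(\<Sum>k<n. hausdorff1 (R k)) \<le> (\<Sum>k<n. hausdorff1 (R (2*k)) + hausdorff1 (R (2*k+1)))" for n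
  proof -
    have "(\<Sum>k<n. hausdorff1 (R k)) \<le> (\<Sum>k<2*n. hausdorff1 (R k))"
      by (intro sum_mono2) auto
    also have "\<dots> = (\<Sum>k<n. hausdorff1 (R (2*k)) + hausdorff1 (R (2*k+1)))"
      by (induction n) (auto simp: algebra_simps)
    finally show ?thesis .
  qed
  ultimately have pair_le: "(\<Sum>k<n. hausdorff1 (R k)) \<le> hausdorff1 S + hausdorff1 S" for n
    using sum_le_suminf[OF summableI, of "{..<n}" "\<lambda>k. hausdorff1 (R (2*k)) + hausdorff1 (R (2*k+1))"]
    by (metis (no_types, lifting) finite_lessThan order_trans zero_le)
  have "(\<Sum>k. hausdorff1 (R k)) \<le> hausdorff1 S + hausdorff1 S"
    by (rule suminf_le_const[OF summableI pair_le])
  then have sumfin: "(\<Sum>k. hausdorff1 (R k)) \<noteq> \<infinity>"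
    using fin by (auto simp: top_unique)
  have tail: "(\<lambda>n. \<Sum>k. hausdorff1 (R (k + n))) \<longlonglongrightarrow> 0"
  proof -
    have r: "\<And>k. hausdorff1 (R k) = ennreal (enn2real (hausdorff1 (R k)))"
      using sumfin ennreal_suminf_neq_top by (metis ennreal_enn2real infinity_ennreal_def less_top ennreal_suminf_lessD)
    define g where "g k = enn2real (hausdorff1 (R k))" for k
    have gs: "summable g" using sumfin r unfolding g_def
      by (intro summable_suminf_not_top) (auto simp flip: r)
    have "(\<lambda>n. \<Sum>k. g (k + n)) \<longlonglongrightarrow> 0" by (rule suminf_exist_split2[OF gs])
    then have "(\<lambda>n. ennreal (\<Sum>k. g (k + n))) \<longlonglongrightarrow> ennreal 0" by (rule tendsto_ennrealI)
    moreover have "ennreal (\<Sum>k. g (k + n)) = (\<Sum>k. hausdorff1 (R (k + n)))" for n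
      using r by (subst suminf_ennreal2[symmetric]) (auto simp: g_def gs summable_ignore_initial_segment intro!: suminf_cong summable_iff_shift[THEN iffD2, OF gs[unfolded g_def]])
    ultimately show ?thesis by simp
  qed
  have le: "hausdorff1 (S \<inter> {x. f x \<le> c}) + hausdorff1 (S \<inter> {x. c < f x})
      \<le> hausdorff1 S + (\<Sum>k. hausdorff1 (R (k + n)))" for n
  proof -
    have "S \<inter> {x. c < f x} \<subseteq> T n \<union> (\<Union>k. R (k + n))"
    proof
      fix x assume x: "x \<in> S \<inter> {x. c < f x}"
      show "x \<in> T n \<union> (\<Union>k. R (k + n))"
      proof (cases "x \<in> T n")
        case False
        define m where "m = (LEAST m. c + inverse (real (Suc m)) < f x)"
        have ex: "\<exists>m. c + inverse (real (Suc m)) < f x"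
          using reals_Archimedean[of "f x - c"] x by (auto simp: algebra_simps)
        have m: "c + inverse (real (Suc m)) < f x" unfolding m_def by (rule LeastI_ex[OF ex])
        have "n < m"
        proof (rule ccontr)
          assume "\<not> n < m"
          then have "inverse (real (Suc n)) \<le> inverse (real (Suc m))"
            by (intro le_imp_inverse_le) auto
          moreover have "\<not> c + inverse (real (Suc n)) < f x" using False x by (auto simp: T_def)
          ultimately show False using m by linarith
        qed
        then obtain k where k: "m = Suc (k + n)" by (metis add.commute less_iff_Suc_add add_Suc_right)
        have "\<not> c + inverse (real (Suc (k + n))) < f x"
          using not_less_Least[of "k+n" "\<lambda>m. c + inverse (real (Suc m)) < f x"] k m_def by auto
        then have "x \<in> R (k + n)" using m x k by (auto simp: R_def)
        then show ?thesis by blast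
      qed auto
    qed
    then have "hausdorff1 (S \<inter> {x. c < f x}) \<le> hausdorff1 (T n) + (\<Sum>k. hausdorff1 (R (k + n)))"
      by (rule order_trans[OF order_trans[OF hausdorff1_mono hausdorff1_Un] add_left_mono[OF hausdorff1_subadditive]])
    then have "hausdorff1 (S \<inter> {x. f x \<le> c}) + hausdorff1 (S \<inter> {x. c < f x})
      \<le> (hausdorff1 (S \<inter> {x. f x \<le> c}) + hausdorff1 (T n)) + (\<Sum>k. hausdorff1 (R (k + n)))"
      by (simp add: add.assoc add_left_mono)
    also have "hausdorff1 (S \<inter> {x. f x \<le> c}) + hausdorff1 (T n) \<le> hausdorff1 ((S \<inter> {x. f x \<le> c}) \<union> T n)"
    proof (rule hausdorff1_separated)
      show "0 < inverse (real (Suc n))" by simp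
      fix x y assume "x \<in> S \<inter> {x. f x \<le> c}" "y \<in> T n"
      then show "inverse (real (Suc n)) \<le> dist x y" using lip[of x y] by (auto simp: T_def)
    qed
    also have "\<dots> \<le> hausdorff1 S" by (intro hausdorff1_mono) (auto simp: T_def)
    finally show ?thesis by (simp add: add_right_mono)
  qed
  have "(\<lambda>n. hausdorff1 S + (\<Sum>k. hausdorff1 (R (k + n)))) \<longlonglongrightarrow> hausdorff1 S + 0"
    by (intro tendsto_add tail tendsto_const)
  then show ?thesis using le by (simp add: LIMSEQ_le_const)
qed

text \<open>
  The sublevel sets of the two coordinates are Caratheodory measurable for the outer measure
  \<open>A \<mapsto> hausdorff1 (A \<inter> E)\<close> and generate the Borel sets of the plane.
\<close>

lemma hausdorff1_restricted_measure:
  fixes E :: "(real \<times> real) set"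
  assumes fin: "hausdorff1 E < \<infinity>"
  obtains \<mu> where "sets \<mu> = sets borel" "finite_measure \<mu>"
    "\<And>A. A \<in> sets borel \<Longrightarrow> emeasure \<mu> A = hausdorff1 (A \<inter> E)"
proof -
  let ?m = "\<lambda>A. hausdorff1 (A \<inter> E)"
  let ?L = "lambda_system UNIV UNIV ?m"
  interpret P: sigma_algebra "UNIV :: (real \<times> real) set" UNIV
    using sigma_algebra_Pow[of "UNIV :: (real \<times> real) set"] by simp
  have ms: "measure_space UNIV ?L ?m"
    by (rule P.caratheodory_lemma[OF outer_measure_space_hausdorff1])
  have lev: "{x. f x \<le> c} \<in> ?L" if lip: "\<And>x y :: real \<times> real. \<bar>f x - f y\<bar> \<le> dist x y"
    for f :: "real \<times> real \<Rightarrow> real" and c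
    unfolding P.lambda_system_eq
  proof (clarsimp, rule antisym)
    fix S
    have "hausdorff1 (S \<inter> E) \<le> hausdorff1 E" by (intro hausdorff1_mono) auto
    then have "hausdorff1 (S \<inter> E) < \<infinity>" using fin by auto
    from hausdorff1_split_sublevel[OF lip this, of c]
    show "?m (S \<inter> {x. f x \<le> c}) + ?m (S - {x. f x \<le> c}) \<le> ?m S"
      by (simp add: Int_ac Int_Diff not_le set_diff_eq Collect_conj_eq)
    show "?m S \<le> ?m (S \<inter> {x. f x \<le> c}) + ?m (S - {x. f x \<le> c})"
      by (rule order_trans[OF _ hausdorff1_Un]) (auto intro!: hausdorff1_mono)
  qed
  have L: "sigma_algebra UNIV ?L" using ms by (simp add: measure_space_def)
  have lip_fst: "\<bar>fst x - fst y\<bar> \<le> dist x y" and lip_snd: "\<bar>snd x - snd y\<bar> \<le> dist x y"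
    for x y :: "real \<times> real"
    using dist_fst_le[of x y] dist_snd_le[of x y] by (simp_all add: dist_real_def)
  have m1: "fst \<in> measurable (sigma UNIV ?L) borel"
    using lev[OF lip_fst] L
    by (intro borel_measurableI_le) (auto simp del: split_paired_All simp: sigma_algebra.sigma_sets_eq space_measure_of_conv)
  have m2: "snd \<in> measurable (sigma UNIV ?L) borel"
    using lev[OF lip_snd] L
    by (intro borel_measurableI_le) (auto simp del: split_paired_All simp: sigma_algebra.sigma_sets_eq space_measure_of_conv)
  have "(\<lambda>x. (fst x, snd x)) \<in> measurable (sigma UNIV ?L) (borel \<Otimes>\<^sub>M borel)"
    using m1 m2 by (rule measurable_Pair)
  then have "(\<lambda>x. x) \<in> measurable (sigma UNIV ?L) (borel :: (real \<times> real) measure)"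
    by (simp add: borel_prod)
  then have sub: "sets (borel :: (real \<times> real) measure) \<subseteq> ?L"
    using L by (auto dest!: measurable_sets simp: sigma_algebra.sigma_sets_eq space_measure_of_conv)
  define \<mu> where "\<mu> = measure_of UNIV (sets (borel :: (real \<times> real) measure)) ?m"
  have ms': "measure_space UNIV (sets (borel :: (real \<times> real) measure)) ?m"
    using measure_down[OF ms _ sub] sets.sigma_algebra_axioms[of borel] by simp
  have s: "sets \<mu> = sets borel" unfolding \<mu>_def
    using sets.sigma_sets_eq[of borel] by (simp add: sets_measure_of_conv)
  have e: "emeasure \<mu> A = ?m A" if "A \<in> sets borel" for A
    unfolding \<mu>_def using that ms'
    by (intro emeasure_measure_of_sigma) (auto simp: measure_space_def)
  show ?thesis
  proof (rule that[OF s _ e])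
    have "space \<mu> = UNIV" using sets_eq_imp_space_eq[OF s] by simp
    then show "finite_measure \<mu>"
      by (intro finite_measureI) (use e[of UNIV] fin in auto)
  qed
qed

section \<open>Lipschitz functions on sets of finite length\<close>

lemma negligibleI_emeasure:
  fixes S :: "real set"
  assumes "\<And>e::real. 0 < e \<Longrightarrow> \<exists>T\<in>sets borel. S \<subseteq> T \<and> emeasure lborel T \<le> ennreal e"
  shows "negligible S"
proof (rule negligible_outer_le[THEN iffD2], intro allI impI)
  fix e :: real assume "0 < e"
  then obtain T where T: "T \<in> sets borel" "S \<subseteq> T" "emeasure lborel T \<le> ennreal e" using assms by blast
  then have "emeasure lborel T < \<infinity>" by (auto simp: le_less_trans)
  then have "T \<in> lmeasurable" "measure lebesgue T \<le> e"
    using T \<open>0 < e\<close> by (auto simp: fmeasurable_def measure_def emeasure_completion enn2real_leI)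
  then show "\<exists>T. S \<subseteq> T \<and> T \<in> lmeasurable \<and> measure lebesgue T \<le> e" using T by blast
qed

lemma emeasure_lborel_cball_real: "0 \<le> r \<Longrightarrow> emeasure lborel (cball (t::real) r) = ennreal (2 * r)"
  by (simp add: cball_eq_atLeastAtMost)

lemma hausdorff1_image_le:
  fixes f :: "'a::real_normed_vector \<Rightarrow> 'b::real_normed_vector"
  assumes f: "\<And>x y. x \<in> A \<Longrightarrow> y \<in> A \<Longrightarrow> dist (f x) (f y) \<le> dist x y"
  shows "hausdorff1 (f ` A) \<le> hausdorff1 A"
proof -
  have "hausdorff1_pre \<delta> (f ` A) \<le> hausdorff1_pre \<delta> A" if "0 < \<delta>" for \<delta>
    unfolding hausdorff1_pre_def[of \<delta> A]
  proof (rule Inf_greatest, clarify)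
    fix U :: "nat \<Rightarrow> 'a set"
    assume cov: "A \<subseteq> (\<Union>i. U i)" and U: "\<forall>i. bounded (U i) \<and> diameter (U i) \<le> \<delta>"
    have d: "dist (f x) (f y) \<le> diameter (U i)" if "x \<in> U i \<inter> A" "y \<in> U i \<inter> A" for x y i
      using that f[of x y] U diameter_bounded_bound[of "U i" x y] by force
    have di: "diameter (f ` (U i \<inter> A)) \<le> diameter (U i)" for i
      using d[of _ i] U diameter_ge_0[of "U i"] by (intro diameter_le) (auto simp: dist_norm)
    have "bounded (f ` (U i \<inter> A))" for i
    proof (cases "U i \<inter> A = {}")
      case False
      then obtain x where "x \<in> U i \<inter> A" by blast
      then have "f ` (U i \<inter> A) \<subseteq> cball (f x) (diameter (U i))" using d[of x i] by auto
      then show ?thesis using bounded_cball bounded_subset by blast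
    qed simp
    then have "hausdorff1_pre \<delta> (f ` A) \<le> (\<Sum>i. ennreal (diameter (f ` (U i \<inter> A))))"
    proof (intro hausdorff1_pre_le)
      have "A \<subseteq> (\<Union>i. U i \<inter> A)" using cov by blast
      then show "f ` A \<subseteq> (\<Union>i. f ` (U i \<inter> A))" by (metis image_UN image_mono)
      show "diameter (f ` (U i \<inter> A)) \<le> \<delta>" for i using di[of i] U order_trans by blast
    qed
    also have "\<dots> \<le> (\<Sum>i. ennreal (diameter (U i)))"
      by (intro suminf_le ennreal_leI di) auto
    finally show "hausdorff1_pre \<delta> (f ` A) \<le> (\<Sum>i. ennreal (diameter (U i)))" .
  qed
  then show ?thesis unfolding hausdorff1_def by (intro SUP_mono) auto
qed

lemma lipschitz_image_in_cball:
  fixes f :: "'a::metric_space \<Rightarrow> real"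
  assumes "L-lipschitz_on A f" "bounded U"
  obtains t where "f ` (U \<inter> A) \<subseteq> cball t (L * diameter U)"
proof (cases "U \<inter> A = {}")
  case False
  then obtain a where a: "a \<in> U \<inter> A" by blast
  have "dist (f a) (f x) \<le> L * diameter U" if "x \<in> U \<inter> A" for x
    using lipschitz_onD[OF assms(1), of a x] a that diameter_bounded_bound[OF assms(2), of a x]
      lipschitz_on_nonneg[OF assms(1)]
    by (meson IntD1 IntD2 mult_left_mono order_trans)
  then show ?thesis by (intro that[of "f a"]) auto
qed (auto intro: that)

text \<open>
  Each covering set has an image in an interval of length proportional to its diameter.
\<close>

lemma hausdorff1_null_imp_negligible_image:
  fixes f :: "'a::metric_space \<Rightarrow> real"
  assumes L: "L-lipschitz_on A f" and null: "hausdorff1 A = 0"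
  shows "negligible (f ` A)"
proof (rule negligibleI_emeasure)
  fix e :: real assume "0 < e"
  have L0: "0 \<le> L" using L lipschitz_on_nonneg by blast
  have "hausdorff1_pre 1 A \<le> 0" using hausdorff1_pre_le_hausdorff1[of 1 A] null by simp
  then have "hausdorff1_pre 1 A < ennreal (e / (2 * L + 1))" using \<open>0 < e\<close> L0 by simp
  then obtain U where U: "A \<subseteq> (\<Union>i. U i)" "\<And>i. bounded (U i)"
    "(\<Sum>i. ennreal (diameter (U i))) < ennreal (e / (2 * L + 1))"
    by (rule hausdorff1_pre_cover) blast
  have "\<exists>t. f ` (U i \<inter> A) \<subseteq> cball t (L * diameter (U i))" for i
    using lipschitz_image_in_cball[OF L U(2)] by metis
  then obtain t where t: "\<And>i. f ` (U i \<inter> A) \<subseteq> cball (t i) (L * diameter (U i))" by metis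
  let ?T = "\<Union>i. cball (t i) (L * diameter (U i))"
  have "emeasure lborel ?T \<le> (\<Sum>i. emeasure lborel (cball (t i) (L * diameter (U i))))"
    by (intro emeasure_subadditive_countably) auto
  also have "\<dots> = (\<Sum>i. ennreal (2 * L) * ennreal (diameter (U i)))"
    using L0 U(2) by (intro suminf_cong) (simp add: emeasure_lborel_cball_real diameter_ge_0 ennreal_mult[symmetric] mult.assoc)
  also have "\<dots> = ennreal (2 * L) * (\<Sum>i. ennreal (diameter (U i)))" by simp
  also have "\<dots> \<le> ennreal (2 * L) * ennreal (e / (2 * L + 1))"
    using U(3) by (intro mult_left_mono) auto
  also have "\<dots> \<le> ennreal e"
    using L0 \<open>0 < e\<close> by (simp add: ennreal_mult[symmetric] field_simps)
  finally have "emeasure lborel ?T \<le> ennreal e" .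
  moreover have "f ` A \<subseteq> ?T" using U(1) t by blast
  moreover have "?T \<in> sets borel" by auto
  ultimately show "\<exists>T\<in>sets borel. f ` A \<subseteq> T \<and> emeasure lborel T \<le> ennreal e" by blast
qed

text \<open>
  The points of \<open>F\<close> are too far apart for two of them to share a covering set, so they lie in
  different covering sets.
\<close>

lemma card_le_multiplicity_of_fine_cover:
  assumes cov: "E \<subseteq> (\<Union>i. U i)" and bd: "\<And>i. bounded (U i)"
    and F: "finite F" "F \<subseteq> E" "\<And>x y. x \<in> F \<Longrightarrow> y \<in> F \<Longrightarrow> x \<noteq> y \<Longrightarrow> \<eta> \<le> dist x y"
    and fine: "\<And>i. diameter (U i) < \<eta>"
    and I: "\<And>x i. x \<in> F \<Longrightarrow> x \<in> U i \<Longrightarrow> \<beta> \<in> I i"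
  shows "of_nat (card F) \<le> (\<Sum>i. indicator (I i) \<beta> :: ennreal)"
proof -
  have "\<exists>i. x \<in> U i" if "x \<in> F" for x using cov F(2) that by blast
  then obtain j where j: "\<And>x. x \<in> F \<Longrightarrow> x \<in> U (j x)" by metis
  have inj: "inj_on j F"
  proof (rule inj_onI, rule ccontr)
    fix x y assume xy: "x \<in> F" "y \<in> F" "j x = j y" "x \<noteq> y"
    then have "dist x y \<le> diameter (U (j x))" using j[of x] j[of y] bd diameter_bounded_bound by metis
    then show False using F(3) xy fine[of "j x"] by force
  qed
  have "of_nat (card F) = (\<Sum>i\<in>j ` F. indicator (I i) \<beta> :: ennreal)"
    using I j by (simp add: sum.reindex[OF inj])
  also have "\<dots> \<le> (\<Sum>i. indicator (I i) \<beta>)"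
    using F(1) by (intro sum_le_suminf[OF summableI]) auto
  finally show ?thesis .
qed

lemma finite_imp_separated:
  assumes "finite (F :: 'a::metric_space set)"
  obtains \<eta> where "0 < \<eta>" "\<And>x y. x \<in> F \<Longrightarrow> y \<in> F \<Longrightarrow> x \<noteq> y \<Longrightarrow> \<eta> \<le> dist x y"
proof -
  let ?D = "(\<lambda>(x,y). dist x y) ` {p \<in> F \<times> F. fst p \<noteq> snd p}"
  have fin: "finite (insert 1 ?D)" using assms by auto
  show ?thesis
  proof (rule that[of "Min (insert 1 ?D)"])
    show "0 < Min (insert 1 ?D)" using fin by (subst Min_gr_iff) auto
    fix x y assume "x \<in> F" "y \<in> F" "x \<noteq> y"
    then show "Min (insert 1 ?D) \<le> dist x y" by (intro Min_le[OF fin]) force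
  qed
qed

text \<open>
  Take covers of \<open>E\<close> by sets of diameter tending to \<open>0\<close> and bounded total diameter, and count by \<open>g k \<beta>\<close>
  the covering sets whose image may contain \<open>\<beta>\<close>. The integrals of \<open>g k\<close> are bounded, while the
  lower limit of \<open>g k \<beta>\<close> is at least the number of points of the fibre over \<open>\<beta>\<close>. Fatou's lemma concludes.
\<close>

lemma negligible_infinite_fibres:
  fixes f :: "'a::metric_space \<Rightarrow> real"
  assumes fin: "hausdorff1 E < \<infinity>" and L: "L-lipschitz_on E f"
  shows "negligible {\<beta>. infinite {e \<in> E. f e = \<beta>}}"
proof -
  define h where "h = hausdorff1 E + 1"
  have L0: "0 \<le> L" using L lipschitz_on_nonneg by blast
  have "\<exists>U. E \<subseteq> (\<Union>i. U i) \<and> (\<forall>i. bounded (U i)) \<and> (\<forall>i. diameter (U i) \<le> inverse (real (Suc k))) \<and>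
     (\<Sum>i. ennreal (diameter (U i))) \<le> h" for k
  proof -
    have "hausdorff1_pre (inverse (real (Suc k))) E \<le> hausdorff1 E" by (intro hausdorff1_pre_le_hausdorff1) simp
    also have "hausdorff1 E < h" unfolding h_def using fin by (simp add: ennreal_add_left_cancel_less[of _ 0, simplified])
    finally show ?thesis by (rule hausdorff1_pre_cover) (use less_imp_le in blast)
  qed
  then obtain U where U: "\<And>k. E \<subseteq> (\<Union>i. U k i)" "\<And>k i. bounded (U k i)"
    "\<And>k i. diameter (U k i) \<le> inverse (real (Suc k))" "\<And>k. (\<Sum>i. ennreal (diameter (U k i))) \<le> h"
    by metis
  have "\<exists>t. f ` (U k i \<inter> E) \<subseteq> cball t (L * diameter (U k i))" for k i
    using lipschitz_image_in_cball[OF L U(2)] by metis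
  then obtain t where t: "\<And>k i. f ` (U k i \<inter> E) \<subseteq> cball (t k i) (L * diameter (U k i))" by metis
  define I where "I k i = cball (t k i) (L * diameter (U k i))" for k i
  define g where "g k \<beta> = (\<Sum>i. indicator (I k i) \<beta> :: ennreal)" for k \<beta>
  have [measurable]: "I k i \<in> sets borel" for k i by (simp add: I_def)
  have [measurable]: "g k \<in> borel_measurable lborel" for k unfolding g_def by measurable
  have "(\<integral>\<^sup>+\<beta>. g k \<beta> \<partial>lborel) \<le> ennreal (2 * L) * h" for k
  proof -
    have "(\<integral>\<^sup>+\<beta>. g k \<beta> \<partial>lborel) = (\<Sum>i. emeasure lborel (I k i))"
      unfolding g_def by (subst nn_integral_suminf) auto
    also have "\<dots> = (\<Sum>i. ennreal (2 * L) * ennreal (diameter (U k i)))"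
      using L0 U(2) by (intro suminf_cong) (simp add: I_def emeasure_lborel_cball_real diameter_ge_0 ennreal_mult[symmetric] mult.assoc)
    also have "\<dots> = ennreal (2 * L) * (\<Sum>i. ennreal (diameter (U k i)))" by simp
    also have "\<dots> \<le> ennreal (2 * L) * h" using U(4) by (intro mult_left_mono) auto
    finally show ?thesis .
  qed
  then have "liminf (\<lambda>k. \<integral>\<^sup>+\<beta>. g k \<beta> \<partial>lborel) \<le> ennreal (2 * L) * h"
    by (intro Liminf_le) (auto simp: eventually_sequentially)
  then have "(\<integral>\<^sup>+\<beta>. liminf (\<lambda>k. g k \<beta>) \<partial>lborel) \<le> ennreal (2 * L) * h"
    by (intro order_trans[OF nn_integral_liminf]) auto
  also have "\<dots> < \<infinity>" using fin by (simp add: h_def ennreal_mult_less_top)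
  finally have ae: "AE \<beta> in lborel. liminf (\<lambda>k. g k \<beta>) \<noteq> \<infinity>"
    by (intro nn_integral_PInf_AE) auto
  have inf: "liminf (\<lambda>k. g k \<beta>) = \<infinity>" if inf: "infinite {e \<in> E. f e = \<beta>}" for \<beta>
  proof -
    have "of_nat m \<le> liminf (\<lambda>k. g k \<beta>)" for m
    proof (rule Liminf_bounded)
      obtain F where F: "finite F" "card F = m" "F \<subseteq> {e \<in> E. f e = \<beta>}"
        using infinite_arbitrarily_large[OF inf] by blast
      obtain \<eta> where \<eta>: "0 < \<eta>" "\<And>x y. x \<in> F \<Longrightarrow> y \<in> F \<Longrightarrow> x \<noteq> y \<Longrightarrow> \<eta> \<le> dist x y"
        using finite_imp_separated[OF F(1)] by blast
      obtain n where n: "inverse (real (Suc n)) < \<eta>" using reals_Archimedean[OF \<eta>(1)] by blast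
      have "of_nat m \<le> g k \<beta>" if "n \<le> k" for k
        unfolding g_def F(2)[symmetric]
      proof (rule card_le_multiplicity_of_fine_cover[where U="U k" and E=E and \<eta>=\<eta>])
        have "inverse (real (Suc k)) \<le> inverse (real (Suc n))" using that by (intro le_imp_inverse_le) auto
        then show "diameter (U k i) < \<eta>" for i using n U(3)[of k i] by linarith
        show "\<beta> \<in> I k i" if "x \<in> F" "x \<in> U k i" for x i
        proof -
          have "f x \<in> f ` (U k i \<inter> E)" "f x = \<beta>" using that F(3) by auto
          then show ?thesis using t[of k i] by (auto simp: I_def)
        qed
      qed (use U F \<eta> in auto)
      then show "\<forall>\<^sub>F k in sequentially. of_nat m \<le> g k \<beta>" unfolding eventually_sequentially by blast
    qed
    then show ?thesis
      by (metis ennreal_Ex_less_of_nat infinity_ennreal_def leD top.not_eq_extremum)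
  qed
  have "AE \<beta> in lebesgue. \<not> infinite {e \<in> E. f e = \<beta>}"
    using AE_completion[OF ae] by eventually_elim (use inf in auto)
  then obtain N where "N \<in> null_sets lebesgue" "{\<beta>. infinite {e \<in> E. f e = \<beta>}} \<subseteq> N"
    unfolding eventually_ae_filter by auto
  then show ?thesis using negligible_iff_null_sets negligible_subset by blast
qed

section \<open>Vitali covering arguments on the line\<close>

text \<open>
  The common form of the four covering arguments that follow. To every \<open>t\<close> in \<open>V\<close> belong a ball and a
  set \<open>D t\<close> whose \<open>N\<close>-measure is controlled by the \<open>M\<close>-measure of the ball inside \<open>W\<close>. Vitali's lemma gives
  disjoint balls whose fivefold enlargements cover \<open>V\<close>. By disjointness the bounds add up to the
  \<open>M\<close>-measure of \<open>W\<close>.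
\<close>

lemma vitali_comparison:
  fixes V :: "real set" and r :: "real \<Rightarrow> real" and M :: "real measure" and N :: "'b measure"
  assumes r: "\<And>t. t \<in> V \<Longrightarrow> 0 < r t \<and> r t \<le> b"
    and M: "sets M = sets borel" and W: "W \<in> sets borel"
    and D: "\<And>t. t \<in> V \<Longrightarrow> D t \<in> sets N"
    and le: "\<And>t. t \<in> V \<Longrightarrow> emeasure N (D t) \<le> c * emeasure M (ball t (r t) \<inter> W)"
  shows "\<exists>C\<subseteq>V. V \<subseteq> (\<Union>t\<in>C. cball t (5 * r t)) \<and>
    (\<Union>t\<in>C. D t) \<in> sets N \<and> emeasure N (\<Union>t\<in>C. D t) \<le> c * emeasure M W"
proof -
  have "V \<subseteq> (\<Union>t\<in>V. cball t (r t))"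
  proof
    fix t assume "t \<in> V"
    then show "t \<in> (\<Union>t\<in>V. cball t (r t))" using r[of t] by (intro UN_I[of t]) auto
  qed
  then obtain C where C: "countable C" "C \<subseteq> V"
     "pairwise (\<lambda>i j. disjnt (cball i (r i)) (cball j (r j))) C"
     "V \<subseteq> (\<Union>i\<in>C. cball i (5 * r i))"
    by (rule Vitali_covering_lemma_cballs[where S=V and K=V and a="\<lambda>t. t" and r=r and B=b]) (use r in auto)
  have disj: "disjoint_family_on (\<lambda>t. ball t (r t) \<inter> W) C"
    unfolding disjoint_family_on_def
  proof (intro ballI impI)
    fix s t assume "s \<in> C" "t \<in> C" "s \<noteq> t"
    then have "cball s (r s) \<inter> cball t (r t) = {}" using C(3) by (auto simp: pairwise_def disjnt_def)
    then show "(ball s (r s) \<inter> W) \<inter> (ball t (r t) \<inter> W) = {}"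
      using ball_subset_cball[of s "r s"] ball_subset_cball[of t "r t"] by blast
  qed
  have bM: "ball t (r t) \<inter> W \<in> sets M" for t using W M by simp
  have DC: "(\<Union>t\<in>C. D t) \<in> sets N" using C D by (intro sets.countable_UN') auto
  have "emeasure N (\<Union>t\<in>C. D t) \<le> c * emeasure M W"
  proof (cases "C = {}")
    case False
    define f where "f = from_nat_into C"
    have f: "range f = C" using C(1) False by (simp add: f_def range_from_nat_into)
    define D' where "D' n = (if f n \<in> f ` {..<n} then {} else D (f n))" for n
    define B' where "B' n = (if f n \<in> f ` {..<n} then {} else ball (f n) (r (f n)) \<inter> W)" for n
    have fC: "f n \<in> C" for n using f by auto
    have U: "(\<Union>t\<in>C. D t) = (\<Union>n. D' n)"
    proof (intro set_eqI iffI)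
      fix x assume "x \<in> (\<Union>t\<in>C. D t)"
      then obtain n where n: "x \<in> D (f n)" unfolding f[symmetric] by auto
      define m where "m = (LEAST m. f m = f n)"
      have m: "f m = f n" unfolding m_def by (rule LeastI[of _ n]) simp
      have "f k \<noteq> f n" if "k < m" for k
        using not_less_Least[OF that[unfolded m_def]] .
      then have "f m \<notin> f ` {..<m}" using m by (metis imageE lessThan_iff)
      then have "x \<in> D' m" using n m by (simp add: D'_def)
      then show "x \<in> (\<Union>n. D' n)" by blast
    next
      fix x assume "x \<in> (\<Union>n. D' n)"
      then obtain n where "x \<in> D' n" by blast
      then have "x \<in> D (f n)" by (simp add: D'_def split: if_splits)
      then show "x \<in> (\<Union>t\<in>C. D t)" using fC[of n] by blast
    qed
    have djB: "disjoint_family B'"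
      unfolding disjoint_family_on_def
    proof (intro ballI impI)
      have *: "B' m \<inter> B' n = {}" if "m < n" for m n
      proof (cases "f m = f n")
        case True
        then have "f n \<in> f ` {..<n}" using that by (metis imageI lessThan_iff)
        then show ?thesis by (simp add: B'_def)
      next
        case False
        then have "(ball (f m) (r (f m)) \<inter> W) \<inter> (ball (f n) (r (f n)) \<inter> W) = {}"
          using disj fC by (auto simp: disjoint_family_on_def)
        then show ?thesis by (auto simp: B'_def)
      qed
      fix m n :: nat assume "m \<noteq> n"
      then show "B' m \<inter> B' n = {}" using *[of m n] *[of n m] by (metis inf_commute linorder_neqE_nat)
    qed
    have sB: "range B' \<subseteq> sets M" using bM by (auto simp: B'_def)
    have sD: "range D' \<subseteq> sets N" using D C(2) fC by (auto simp: D'_def)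
    have "emeasure N (\<Union>t\<in>C. D t) \<le> (\<Sum>n. emeasure N (D' n))"
      unfolding U by (rule emeasure_subadditive_countably[OF sD])
    also have "\<dots> \<le> (\<Sum>n. c * emeasure M (B' n))"
      using le C(2) fC by (intro suminf_le) (auto simp: D'_def B'_def)
    also have "\<dots> = c * emeasure M (\<Union>n. B' n)"
      using suminf_emeasure[OF sB djB] by simp
    also have "\<dots> \<le> c * emeasure M W"
      using M W by (intro mult_left_mono emeasure_mono) (auto simp: B'_def)
    finally show "emeasure N (\<Union>t\<in>C. D t) \<le> c * emeasure M W" .
  qed simp
  then show ?thesis using C DC by blast
qed

text \<open>
  The weak type inequality for the maximal function of \<open>\<kappa>\<close>: the set where it exceeds \<open>M\<close> has measure
  of order \<open>\<kappa>(UNIV) / M\<close>.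
\<close>

lemma negligible_infinite_maximal_density:
  fixes \<kappa> :: "real measure"
  assumes s: "sets \<kappa> = sets borel" and fin: "finite_measure \<kappa>"
  shows "negligible {t. \<forall>M>0. \<exists>\<rho>>0. M * \<rho> < measure \<kappa> (ball t \<rho>)}" 
proof (rule negligibleI_emeasure)
  interpret finite_measure \<kappa> by fact
  define V where "V = {t. \<forall>M>0. \<exists>\<rho>>0. M * \<rho> < measure \<kappa> (ball t \<rho>)}"
  fix e :: real assume e: "0 < e"
  define m where "m = measure \<kappa> (space \<kappa>) + 1"
  have m: "0 < m" by (simp add: m_def add_nonneg_pos)
  define M where "M = 10 * m / e"
  have M: "0 < M" using m e by (simp add: M_def)
  have "\<forall>t\<in>V. \<exists>\<rho>. 0 < \<rho> \<and> M * \<rho> < measure \<kappa> (ball t \<rho>)" using M unfolding V_def by blast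
  from bchoice[OF this] obtain r where r: "\<And>t. t \<in> V \<Longrightarrow> 0 < r t \<and> M * r t < measure \<kappa> (ball t (r t))" by blast
  have bd: "r t \<le> m / M" if "t \<in> V" for t
  proof -
    have "M * r t < m" using r[OF that] bounded_measure[of "ball t (r t)"] by (simp add: m_def)
    then show ?thesis using M by (simp add: field_simps)
  qed
  have "\<exists>C\<subseteq>V. V \<subseteq> (\<Union>t\<in>C. cball t (5 * r t)) \<and>
    (\<Union>t\<in>C. cball t (5 * r t)) \<in> sets lborel \<and>
    emeasure lborel (\<Union>t\<in>C. cball t (5 * r t)) \<le> ennreal (10 / M) * emeasure \<kappa> UNIV"
  proof (rule vitali_comparison[of V r "m / M" \<kappa> UNIV "\<lambda>t. cball t (5 * r t)" lborel "ennreal (10 / M)"])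
    fix t assume t: "t \<in> V"
    have "5 * (r t * 2) \<le> 10 / M * measure \<kappa> (ball t (r t))"
      using r[OF t] M by (simp add: field_simps)
    then show "emeasure lborel (cball t (5 * r t)) \<le> ennreal (10 / M) * emeasure \<kappa> (ball t (r t) \<inter> UNIV)"
      using r[OF t] M by (simp add: emeasure_lborel_cball_real emeasure_eq_measure ennreal_mult[symmetric] ennreal_leI)
    show "0 < r t \<and> r t \<le> m / M" using r[OF t] bd[OF t] by simp
  qed (use s in simp_all)
  then obtain C where C: "C \<subseteq> V" "V \<subseteq> (\<Union>t\<in>C. cball t (5 * r t))"
    "(\<Union>t\<in>C. cball t (5 * r t)) \<in> sets lborel"
    "emeasure lborel (\<Union>t\<in>C. cball t (5 * r t)) \<le> ennreal (10 / M) * emeasure \<kappa> UNIV"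
    by blast
  have "10 / M * measure \<kappa> UNIV \<le> e"
  proof -
    have "space \<kappa> = UNIV" using sets_eq_imp_space_eq[OF s] by simp
    then have "measure \<kappa> UNIV \<le> m" by (simp add: m_def)
    then show ?thesis using e m by (simp add: M_def field_simps)
  qed
  then have "emeasure lborel (\<Union>t\<in>C. cball t (5 * r t)) \<le> ennreal e"
    using C(4) M by (simp add: emeasure_eq_measure ennreal_mult[symmetric]) (meson ennreal_leI order_trans)
  then show "\<exists>T\<in>sets borel. {t. \<forall>M>0. \<exists>\<rho>>0. M * \<rho> < measure \<kappa> (ball t \<rho>)} \<subseteq> T \<and> emeasure lborel T \<le> ennreal e" using C unfolding V_def by auto
qed

text \<open>
  A consequence of Lebesgue's density theorem, obtained directly from the covering lemma: balls inside a
  neighbourhood \<open>U\<close> of \<open>K\<close> whose gaps have a fixed proportion bound the measure of \<open>K\<close> by a multiple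
  of that of \<open>U - K\<close>, which is as small as desired.
\<close>

lemma null_if_porous:
  fixes K :: "real set"
  assumes K: "compact K" and \<kappa>: "0 < \<kappa>"
    and gap: "\<And>a \<eta>. a \<in> K \<Longrightarrow> 0 < \<eta> \<Longrightarrow>
      \<exists>\<rho>>0. \<rho> < \<eta> \<and> ennreal (\<kappa> * \<rho>) \<le> emeasure lborel (ball a \<rho> - K)"
  shows "emeasure lborel K = 0"
proof -
  have le_eps: "emeasure lborel K \<le> 0 + ennreal e" if e: "0 < e" for e
  proof -
    define e' where "e' = \<kappa> / 10 * e"
    have e': "0 < e'" using e \<kappa> by (simp add: e'_def)
    have Kb: "K \<in> sets borel" using K by (simp add: borel_compact)
    have Kl: "K \<in> sets lebesgue" using Kb by auto
    obtain U where U: "open U" "K \<subseteq> U" "U - K \<in> lmeasurable" "emeasure lebesgue (U - K) < ennreal e'"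
      using sets_lebesgue_outer_open[OF Kl e'] by metis
    have UK: "emeasure lborel (U - K) \<le> ennreal e'"
      using U(1,4) Kb by (simp add: emeasure_completion)
    have "\<exists>\<rho>>0. \<rho> \<le> 1 \<and> ball a \<rho> \<subseteq> U \<and> ennreal (\<kappa> * \<rho>) \<le> emeasure lborel (ball a \<rho> - K)" if a: "a \<in> K" for a
    proof -
      obtain \<eta> where \<eta>: "0 < \<eta>" "ball a \<eta> \<subseteq> U" using U a open_contains_ball by blast
      obtain \<rho> where "\<rho> > 0" "\<rho> < min \<eta> 1" "ennreal (\<kappa> * \<rho>) \<le> emeasure lborel (ball a \<rho> - K)"
        using gap[OF a, of "min \<eta> 1"] \<eta> by auto
      then show ?thesis using \<eta>(2) subset_ball[of \<rho> \<eta> a] by (intro exI[of _ \<rho>]) auto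
    qed
    then obtain r where r: "\<And>a. a \<in> K \<Longrightarrow> 0 < r a \<and> r a \<le> 1 \<and> ball a (r a) \<subseteq> U \<and>
        ennreal (\<kappa> * r a) \<le> emeasure lborel (ball a (r a) - K)" by metis
    have "\<exists>C\<subseteq>K. K \<subseteq> (\<Union>t\<in>C. cball t (5 * r t)) \<and>
      (\<Union>t\<in>C. cball t (5 * r t)) \<in> sets lborel \<and>
      emeasure lborel (\<Union>t\<in>C. cball t (5 * r t)) \<le> ennreal (10 / \<kappa>) * emeasure lborel (U - K)"
    proof (rule vitali_comparison[of K r 1 lborel "U - K" "\<lambda>t. cball t (5 * r t)" lborel "ennreal (10 / \<kappa>)"])
      fix t assume t: "t \<in> K"
      have "emeasure lborel (cball t (5 * r t)) = ennreal (10 / \<kappa>) * ennreal (\<kappa> * r t)"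
        using r[OF t] \<kappa> by (simp add: emeasure_lborel_cball_real ennreal_mult[symmetric])
      also have "\<dots> \<le> ennreal (10 / \<kappa>) * emeasure lborel (ball t (r t) - K)"
        using r[OF t] by (intro mult_left_mono) auto
      also have "ball t (r t) - K = ball t (r t) \<inter> (U - K)" using r[OF t] by blast
      finally show "emeasure lborel (cball t (5 * r t)) \<le> ennreal (10 / \<kappa>) * emeasure lborel (ball t (r t) \<inter> (U - K))" .
      show "0 < r t \<and> r t \<le> 1" using r[OF t] by simp
    qed (use U(1) Kb in simp_all)
    then obtain C where C: "K \<subseteq> (\<Union>t\<in>C. cball t (5 * r t))"
      "(\<Union>t\<in>C. cball t (5 * r t)) \<in> sets lborel"
      "emeasure lborel (\<Union>t\<in>C. cball t (5 * r t)) \<le> ennreal (10 / \<kappa>) * emeasure lborel (U - K)"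
      by blast
    have "emeasure lborel K \<le> emeasure lborel (\<Union>t\<in>C. cball t (5 * r t))"
      using C(1,2) by (rule emeasure_mono)
    also note C(3)
    also have "ennreal (10 / \<kappa>) * emeasure lborel (U - K) \<le> ennreal (10 / \<kappa>) * ennreal e'"
      using UK by (intro mult_left_mono) auto
    also have "\<dots> = ennreal e" using \<kappa> e by (simp add: e'_def ennreal_mult[symmetric])
    finally show ?thesis by simp
  qed
  have "emeasure lborel K \<le> 0"
  proof (rule ennreal_le_epsilon)
    fix e :: real assume "0 < e"
    then show "emeasure lborel K \<le> 0 + ennreal e" by (rule le_eps)
  qed
  then show ?thesis by simp
qed

text \<open>
  In the coordinates \<open>u, v\<close>, let \<open>h a\<close> be the largest horizontal distance from \<open>a\<close> to a point \<open>b\<close> of \<open>A\<close>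
  in the narrower cone \<open>4 \<bar>v b - v a\<bar> \<le> s \<bar>u b - u a\<bar>\<close>. Where \<open>h\<close> vanishes, \<open>u\<close> is a Lipschitz function
  of \<open>v\<close>, and \<open>graph\<close> applies. Otherwise pick \<open>c\<close> in the cone that almost realizes \<open>h a\<close>. A point of \<open>A\<close> in the
  strip of width comparable to \<open>s h a\<close> around \<open>a\<close> cannot be outside both wide cones with vertices \<open>a\<close> and \<open>c\<close>,
  since these vertices are far apart, so the strip has measure at most \<open>6 l s h a\<close>, a multiple of \<open>l\<close>
  times its width. Covering the values of \<open>v\<close> by such strips gives the bound.
\<close>

lemma measure_le_of_thin_cones:
  fixes \<mu> :: "'a measure" and u v :: "'a \<Rightarrow> real"
  assumes fin: "finite_measure \<mu>" and um: "u \<in> borel_measurable \<mu>" and vm: "v \<in> borel_measurable \<mu>"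
    and A: "A \<in> sets \<mu>" and s: "0 < s" "s \<le> 1" and lam: "0 \<le> l" and B: "0 < B"
    and uB: "\<And>a. a \<in> A \<Longrightarrow> \<bar>u a\<bar> \<le> B" and vB: "\<And>a. a \<in> A \<Longrightarrow> \<bar>v a\<bar> \<le> B"
    and cone: "\<And>a r. a \<in> A \<Longrightarrow> 0 < r \<Longrightarrow>
      measure \<mu> {b \<in> space \<mu>. \<bar>u b - u a\<bar> < r \<and> \<bar>v b - v a\<bar> < s * \<bar>u b - u a\<bar>} \<le> l * r * s"
    and graph: "\<And>A0. A0 \<subseteq> A \<Longrightarrow> (\<And>a b. a \<in> A0 \<Longrightarrow> b \<in> A0 \<Longrightarrow> s * \<bar>u b - u a\<bar> \<le> 4 * \<bar>v b - v a\<bar>)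
      \<Longrightarrow> \<exists>N\<in>null_sets \<mu>. A0 \<subseteq> N"
  shows "measure \<mu> A \<le> 480 * l * B"
proof -
  interpret finite_measure \<mu> by fact
  note [measurable] = um vm A
  define P where "P a b \<longleftrightarrow> b \<in> A \<and> 4 * \<bar>v b - v a\<bar> \<le> s * \<bar>u b - u a\<bar>" for a b
  define A0 where "A0 = {a \<in> A. \<forall>b. P a b \<longrightarrow> u b = u a}"
  define h where "h a = (SUP b\<in>{b. P a b}. \<bar>u b - u a\<bar>)" for a
  have bdd: "bdd_above ((\<lambda>b. \<bar>u b - u a\<bar>) ` {b. P a b})" if "a \<in> A" for a
  proof (rule bdd_aboveI[of _ "2 * B"])
    fix x assume "x \<in> (\<lambda>b. \<bar>u b - u a\<bar>) ` {b. P a b}"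
    then obtain b where "b \<in> A" "x = \<bar>u b - u a\<bar>" by (auto simp: P_def)
    then show "x \<le> 2 * B" using uB[OF that] uB[of b] by linarith
  qed
  have h_upper: "\<bar>u b - u a\<bar> \<le> h a" if "a \<in> A" "P a b" for a b
    unfolding h_def using that by (intro cSUP_upper bdd) auto
  have Paa: "P a a" if "a \<in> A" for a using that by (simp add: P_def)
  have h_le: "h a \<le> 2 * B" if "a \<in> A" for a
    unfolding h_def
  proof (rule cSUP_least)
    fix b assume "b \<in> {b. P a b}"
    then show "\<bar>u b - u a\<bar> \<le> 2 * B" using uB[OF that] uB[of b] by (auto simp: P_def)
  qed (use Paa[OF that] in auto)
  have h_pos: "0 < h a" if "a \<in> A - A0" for a
    using that h_upper[of a] by (force simp: A0_def)
  obtain N where N: "N \<in> null_sets \<mu>" "A0 \<subseteq> N"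
  proof -
    have "\<exists>N\<in>null_sets \<mu>. A0 \<subseteq> N"
    proof (rule graph)
      fix a b assume "a \<in> A0" "b \<in> A0"
      then show "s * \<bar>u b - u a\<bar> \<le> 4 * \<bar>v b - v a\<bar>"
        by (cases "P a b") (auto simp: A0_def P_def)
    qed (auto simp: A0_def)
    then show ?thesis using that by blast
  qed
  have strip: "measure \<mu> {b \<in> A. \<bar>v b - v a\<bar> \<le> s * h a / 8} \<le> 6 * l * s * h a" if a: "a \<in> A - A0" for a
  proof -
    have aA: "a \<in> A" using a by simp
    have h0: "0 < h a" using h_pos[OF a] .
    have "3/4 * h a < h a" using h0 by simp
    then have "\<exists>c\<in>{b. P a b}. 3/4 * h a < \<bar>u c - u a\<bar>"
      using less_cSUP_iff[OF _ bdd[OF aA], of "3/4 * h a"] Paa[OF aA] unfolding h_def[symmetric] by blast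
    then obtain c where c: "P a c" "3/4 * h a < \<bar>u c - u a\<bar>" by blast
    have cA: "c \<in> A" using c by (simp add: P_def)
    have cu: "\<bar>u c - u a\<bar> \<le> h a" using h_upper[OF aA c(1)] .
    have cv: "4 * \<bar>v c - v a\<bar> \<le> s * h a"
    proof -
      have "s * \<bar>u c - u a\<bar> \<le> s * h a" using cu s by (intro mult_left_mono) auto
      then show ?thesis using c(1) unfolding P_def by linarith
    qed
    let ?X = "\<lambda>d. {b \<in> space \<mu>. \<bar>u b - u d\<bar> < 3 * h a \<and> \<bar>v b - v d\<bar> < s * \<bar>u b - u d\<bar>}"
    \<comment> \<open>Outside both cones the vertices would satisfy \<open>\<bar>u c - u a\<bar> \<le> 2 (h a / 8) + h a / 4 < 3/4 h a\<close>.\<close>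
    have "{b \<in> A. \<bar>v b - v a\<bar> \<le> s * h a / 8} \<subseteq> ?X a \<union> ?X c"
    proof
      fix b assume "b \<in> {b \<in> A. \<bar>v b - v a\<bar> \<le> s * h a / 8}"
      then have bA: "b \<in> A" and bv: "\<bar>v b - v a\<bar> \<le> s * h a / 8" by auto
      have bs: "b \<in> space \<mu>" using bA A sets.sets_into_space by blast
      have bu: "\<bar>u b - u a\<bar> \<le> h a"
      proof (rule ccontr)
        assume n: "\<not> ?thesis"
        then have "s * h a \<le> s * \<bar>u b - u a\<bar>" using s by (intro mult_left_mono) auto
        then have "4 * \<bar>v b - v a\<bar> \<le> s * \<bar>u b - u a\<bar>" using bv mult_pos_pos[OF s(1) h0] by argo
        then have "P a b" using bA by (simp add: P_def)
        then show False using h_upper[OF aA] n by blast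
      qed
      have far: "s * (3/4 * h a) < s * \<bar>u c - u a\<bar>" using s c(2) by (intro mult_strict_left_mono) auto
      have tri: "s * \<bar>u c - u a\<bar> \<le> s * \<bar>u b - u a\<bar> + s * \<bar>u b - u c\<bar>"
        using mult_left_mono[of "\<bar>u c - u a\<bar>" "\<bar>u b - u a\<bar> + \<bar>u b - u c\<bar>" s] s by (simp add: distrib_left)
      have sh: "0 < s * h a" using s h0 by simp
      have "\<bar>v b - v a\<bar> < s * \<bar>u b - u a\<bar> \<or> \<bar>v b - v c\<bar> < s * \<bar>u b - u c\<bar>"
        using far tri bv cv sh by (simp add: abs_if split: if_splits) linarith+
      then show "b \<in> ?X a \<union> ?X c" using bs bu cu h0 by auto
    qed
    then have "measure \<mu> {b \<in> A. \<bar>v b - v a\<bar> \<le> s * h a / 8} \<le> measure \<mu> (?X a \<union> ?X c)"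
      by (intro finite_measure_mono) measurable
    also have "\<dots> \<le> measure \<mu> (?X a) + measure \<mu> (?X c)"
      by (intro measure_Un_le) measurable
    also have "\<dots> \<le> l * (3 * h a) * s + l * (3 * h a) * s"
      using h0 by (intro add_mono cone aA cA) auto
    finally show ?thesis by (simp add: algebra_simps)
  qed
  define V where "V = v ` (A - A0)"
  have "\<forall>t\<in>V. \<exists>a\<in>A - A0. v a = t" unfolding V_def by blast
  then obtain p where p: "\<And>t. t \<in> V \<Longrightarrow> p t \<in> A - A0 \<and> v (p t) = t" by metis
  define r where "r t = s * h (p t) / 40" for t
  define D where "D t = {b \<in> A. \<bar>v b - t\<bar> \<le> 5 * r t}" for t
  have r: "0 < r t \<and> r t \<le> B / 20" if "t \<in> V" for t
    using h_pos[of "p t"] h_le[of "p t"] p[OF that] s mult_mono[of s 1 "h (p t)" "2 * B"] B by (simp add: r_def)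
  have "\<exists>C\<subseteq>V. V \<subseteq> (\<Union>t\<in>C. cball t (5 * r t)) \<and> (\<Union>t\<in>C. D t) \<in> sets \<mu> \<and>
    emeasure \<mu> (\<Union>t\<in>C. D t) \<le> ennreal (120 * l) * emeasure lborel {-2 * B..2 * B}"
  proof (rule vitali_comparison[of V r "B/20" lborel "{-2 * B..2 * B}" D \<mu> "ennreal (120 * l)"])
    fix t assume t: "t \<in> V"
    have "ball t (r t) \<subseteq> {-2 * B..2 * B}"
      using r[OF t] p[OF t] vB[of "p t"] by (auto simp: dist_real_def abs_if split: if_splits)
    then have "emeasure lborel (ball t (r t) \<inter> {-2 * B..2 * B}) = ennreal (2 * r t)"
      using r[OF t] by (simp add: Int_absorb2 ball_eq_greaterThanLessThan)
    moreover have "measure \<mu> (D t) \<le> 120 * l * (2 * r t)"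
      using strip[of "p t"] p[OF t] by (simp add: D_def r_def algebra_simps)
    ultimately show "emeasure \<mu> (D t) \<le> ennreal (120 * l) * emeasure lborel (ball t (r t) \<inter> {-2 * B..2 * B})"
      using lam r[OF t] by (simp add: emeasure_eq_measure ennreal_mult[symmetric] ennreal_leI)
    show "D t \<in> sets \<mu>" unfolding D_def by measurable
    show "0 < r t \<and> r t \<le> B / 20" using r[OF t] .
  qed simp_all
  then obtain C where C: "C \<subseteq> V" "V \<subseteq> (\<Union>t\<in>C. cball t (5 * r t))" "(\<Union>t\<in>C. D t) \<in> sets \<mu>"
    "emeasure \<mu> (\<Union>t\<in>C. D t) \<le> ennreal (120 * l) * emeasure lborel {-2 * B..2 * B}"
    by blast
  have "A \<subseteq> N \<union> (\<Union>t\<in>C. D t)"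
  proof
    fix a assume a: "a \<in> A"
    show "a \<in> N \<union> (\<Union>t\<in>C. D t)"
    proof (cases "a \<in> A0")
      case False
      then have "v a \<in> V" using a by (auto simp: V_def)
      then obtain t where "t \<in> C" "v a \<in> cball t (5 * r t)" using C(2) by blast
      then show ?thesis using a by (auto simp: D_def dist_real_def abs_minus_commute)
    qed (use N in auto)
  qed
  then have "emeasure \<mu> A \<le> emeasure \<mu> (N \<union> (\<Union>t\<in>C. D t))"
    using N C by (intro emeasure_mono) auto
  also have "\<dots> = emeasure \<mu> (\<Union>t\<in>C. D t)"
    unfolding Un_commute[of N] using C(3) N(1) by (rule emeasure_Un_null_set)
  also have "\<dots> \<le> ennreal (480 * l * B)"
    using C(4) B lam by (simp add: ennreal_mult[symmetric] algebra_simps)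
  finally show ?thesis using B lam by (simp add: emeasure_eq_measure)
qed

text \<open>
  Inner regularity of Lebesgue measure.
\<close>

lemma lborel_null_if_compact_subsets_null:
  fixes Q :: "real set"
  assumes Q: "Q \<in> sets borel" and comp: "\<And>T. compact T \<Longrightarrow> T \<subseteq> Q \<Longrightarrow> emeasure lborel T = 0"
  shows "emeasure lborel Q = 0"
proof -
  have "emeasure lborel Q \<le> 0"
  proof (rule ennreal_le_epsilon)
    fix e :: real assume e: "0 < e"
    obtain T where T: "closed T" "T \<subseteq> Q" "emeasure lebesgue (Q - T) < ennreal e"
      by (rule sets_lebesgue_inner_closed[of Q e]) (use Q e in auto)
    have Tb: "T \<in> sets borel" using T(1) by (rule borel_closed)
    have "emeasure lborel (T \<inter> cball 0 (real n)) = 0" for n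
      using T by (intro comp) (auto intro: closed_Int_compact)
    then have "emeasure lborel (\<Union>n. T \<inter> cball 0 (real n)) = 0"
      using Tb by (intro emeasure_UN_eq_0) auto
    moreover have "(\<Union>n. T \<inter> cball 0 (real n)) = T"
    proof -
      have "\<exists>n. t \<in> cball 0 (real n)" for t :: real
        using real_arch_simple[of "\<bar>t\<bar>"] by (simp add: dist_real_def)
      then show ?thesis by blast
    qed
    ultimately have T0: "emeasure lborel T = 0" by simp
    have "emeasure lborel Q \<le> emeasure lborel T + emeasure lborel (Q - T)"
      using T(2) Q Tb by (metis Un_Diff_cancel Un_absorb1 emeasure_subadditive sets.Diff sets_lborel)
    also have "\<dots> \<le> 0 + ennreal e" using T(3) T0 Q Tb by (simp add: emeasure_completion)
    finally show "emeasure lborel Q \<le> 0 + ennreal e" .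
  qed
  then show ?thesis by simp
qed

section \<open>The curved projections\<close>

text \<open>
  The sign \<open>\<sigma>\<close> treats increasing and decreasing slopes \<open>\<psi>\<close> at the same time.
\<close>

locale curved_projections =
  fixes \<phi> \<psi> :: "real \<Rightarrow> real" and \<sigma> c K :: real
  assumes deriv: "(\<phi> has_real_derivative \<psi> t) (at t)"
    and sign: "\<bar>\<sigma>\<bar> = 1" and c: "0 < c"
    and lower: "s \<le> t \<Longrightarrow> c * (t - s) \<le> \<sigma> * (\<psi> t - \<psi> s)"
    and upper: "s \<le> t \<Longrightarrow> \<sigma> * (\<psi> t - \<psi> s) \<le> K * (t - s)"
begin

definition \<Phi> :: "real \<Rightarrow> real \<times> real \<Rightarrow> real" where
  "\<Phi> \<alpha> e = snd e - \<phi> (fst e - \<alpha>)"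

lemma \<phi>_continuous: "continuous_on S \<phi>"
  using deriv by (meson DERIV_isCont continuous_at_imp_continuous_on)

lemma \<Phi>_continuous [continuous_intros]:
  "continuous_on S f \<Longrightarrow> continuous_on S g \<Longrightarrow> continuous_on S (\<lambda>x. \<Phi> (f x) (g x))"
  unfolding \<Phi>_def
  by (intro continuous_intros continuous_on_compose2[OF \<phi>_continuous[of UNIV]]) auto

lemma K_pos: "0 < K"
  using lower[of 0 1] upper[of 0 1] c by simp

text \<open>
  The mean value theorem for \<open>z \<mapsto> \<phi> (z - \<alpha>) - \<phi> (z - \<beta>)\<close>, whose derivative compares \<open>\<psi>\<close> at two points at
  distance \<open>\<beta> - \<alpha>\<close>.
\<close>

lemma increment_bounds:
  assumes "x \<le> x'" "\<alpha> \<le> \<beta>"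
  shows "c * (x' - x) * (\<beta> - \<alpha>) \<le> \<sigma> * ((\<phi> (x' - \<alpha>) - \<phi> (x - \<alpha>)) - (\<phi> (x' - \<beta>) - \<phi> (x - \<beta>)))"
    and "\<sigma> * ((\<phi> (x' - \<alpha>) - \<phi> (x - \<alpha>)) - (\<phi> (x' - \<beta>) - \<phi> (x - \<beta>))) \<le> K * (x' - x) * (\<beta> - \<alpha>)"
proof -
  let ?d = "\<sigma> * ((\<phi> (x' - \<alpha>) - \<phi> (x - \<alpha>)) - (\<phi> (x' - \<beta>) - \<phi> (x - \<beta>)))"
  have "c * (x' - x) * (\<beta> - \<alpha>) \<le> ?d \<and> ?d \<le> K * (x' - x) * (\<beta> - \<alpha>)"
  proof (cases "x = x'")
    case False
    have d: "((\<lambda>z. \<phi> (z - a)) has_real_derivative \<psi> (z - a)) (at z)" for z a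
    proof -
      have "((\<lambda>z. z - a) has_real_derivative 1) (at z)" by (auto intro!: derivative_eq_intros)
      from DERIV_chain2[OF deriv this] show ?thesis by simp
    qed
    have "\<exists>z>x. z < x' \<and> (\<phi> (x' - \<alpha>) - \<phi> (x' - \<beta>)) - (\<phi> (x - \<alpha>) - \<phi> (x - \<beta>))
        = (x' - x) * (\<psi> (z - \<alpha>) - \<psi> (z - \<beta>))"
      using assms False by (intro MVT2 DERIV_diff d) auto
    then obtain z where z: "(\<phi> (x' - \<alpha>) - \<phi> (x' - \<beta>)) - (\<phi> (x - \<alpha>) - \<phi> (x - \<beta>))
        = (x' - x) * (\<psi> (z - \<alpha>) - \<psi> (z - \<beta>))" by blast
    have "(\<phi> (x' - \<alpha>) - \<phi> (x - \<alpha>)) - (\<phi> (x' - \<beta>) - \<phi> (x - \<beta>))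
        = (x' - x) * (\<psi> (z - \<alpha>) - \<psi> (z - \<beta>))"
      unfolding z[symmetric] by simp
    then have eq: "?d = (x' - x) * (\<sigma> * (\<psi> (z - \<alpha>) - \<psi> (z - \<beta>)))" by simp
    have "(x' - x) * (c * (\<beta> - \<alpha>)) \<le> ?d" "?d \<le> (x' - x) * (K * (\<beta> - \<alpha>))"
      unfolding eq using lower[of "z - \<beta>" "z - \<alpha>"] upper[of "z - \<beta>" "z - \<alpha>"] assms
      by (auto intro!: mult_left_mono)
    then show ?thesis by (simp add: mult_ac)
  qed simp
  then show "c * (x' - x) * (\<beta> - \<alpha>) \<le> ?d" "?d \<le> K * (x' - x) * (\<beta> - \<alpha>)" by auto
qed

text \<open>
  As a function of \<open>\<alpha>\<close>, the difference \<open>\<Phi> \<alpha> e' - \<Phi> \<alpha> e\<close> is continuous and strictly monotone with slope between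
  two multiples of \<open>\<bar>fst e' - fst e\<bar>\<close>, so it has a zero \<open>a\<close>.
\<close>

lemma transversality:
  assumes "fst e \<noteq> fst e'"
  obtains a where "\<And>\<alpha>. c * \<bar>fst e' - fst e\<bar> * \<bar>\<alpha> - a\<bar> \<le> \<bar>\<Phi> \<alpha> e' - \<Phi> \<alpha> e\<bar>"
    "\<And>\<alpha>. \<bar>\<Phi> \<alpha> e' - \<Phi> \<alpha> e\<bar> \<le> K * \<bar>fst e' - fst e\<bar> * \<bar>\<alpha> - a\<bar>"
proof -
  have "\<exists>a. \<forall>\<alpha>. c * \<bar>fst e' - fst e\<bar> * \<bar>\<alpha> - a\<bar> \<le> \<bar>\<Phi> \<alpha> e' - \<Phi> \<alpha> e\<bar>
      \<and> \<bar>\<Phi> \<alpha> e' - \<Phi> \<alpha> e\<bar> \<le> K * \<bar>fst e' - fst e\<bar> * \<bar>\<alpha> - a\<bar>"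
    if lt: "fst e < fst e'" for e e' :: "real \<times> real"
  proof -
    define w where "w = fst e' - fst e"
    have w: "0 < w" using lt by (simp add: w_def)
    define g where "g \<alpha> = \<sigma> * (\<Phi> \<alpha> e' - \<Phi> \<alpha> e)" for \<alpha>
    have g: "c * w * (\<beta> - \<alpha>) \<le> g \<beta> - g \<alpha>" "g \<beta> - g \<alpha> \<le> K * w * (\<beta> - \<alpha>)" if "\<alpha> \<le> \<beta>" for \<alpha> \<beta>
      using increment_bounds[of "fst e" "fst e'" \<alpha> \<beta>] lt that
      by (auto simp: g_def \<Phi>_def w_def algebra_simps)
    have cont: "continuous_on S g" for S unfolding g_def by (intro continuous_intros)
    define l where "l = \<bar>g 0\<bar> / (c * w)"
    have l: "0 \<le> l" "c * w * l = \<bar>g 0\<bar>" using c w by (auto simp: l_def)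
    have "g (- l) \<le> 0" "0 \<le> g l" using g(1)[of "-l" 0] g(1)[of 0 l] l by auto
    then obtain a where a: "g a = 0" using IVT'[of g "- l" 0 l] cont l by auto
    have ag: "\<bar>\<Phi> \<alpha> e' - \<Phi> \<alpha> e\<bar> = \<bar>g \<alpha>\<bar>" for \<alpha> using sign by (simp add: g_def abs_mult)
    have "c * w * \<bar>\<alpha> - a\<bar> \<le> \<bar>g \<alpha>\<bar> \<and> \<bar>g \<alpha>\<bar> \<le> K * w * \<bar>\<alpha> - a\<bar>" for \<alpha>
    proof (cases "a \<le> \<alpha>")
      case True
      then have "0 \<le> c * w * (\<alpha> - a)" using c w by simp
      then show ?thesis using g[OF True] a True by (auto simp: abs_if)
    next
      case False
      then have "0 \<le> c * w * (a - \<alpha>)" using c w by simp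
      then show ?thesis using g[of \<alpha> a] a False by (auto simp: abs_if)
    qed
    then show ?thesis unfolding ag using w by (auto simp: w_def)
  qed
  from this[of e e'] this[of e' e] assms show ?thesis
    using that by (metis abs_minus_commute linorder_neqE_linordered_idom)
qed

lemma \<phi>_lipschitz:
  assumes "\<bar>s\<bar> \<le> R" "\<bar>t\<bar> \<le> R"
  shows "\<bar>\<phi> s - \<phi> t\<bar> \<le> (\<bar>\<psi> 0\<bar> + K * R) * \<bar>s - t\<bar>"
proof -
  have \<psi>: "\<bar>\<psi> z\<bar> \<le> \<bar>\<psi> 0\<bar> + K * R" if "z \<in> {-R..R}" for z
  proof -
    have "\<bar>\<sigma> * (\<psi> z - \<psi> 0)\<bar> \<le> K * \<bar>z\<bar>"
    proof (cases "0 \<le> z")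
      case True
      have "0 \<le> c * z" using True c by simp
      then show ?thesis using lower[OF True] upper[OF True] True by simp
    next
      case False
      have "0 \<le> c * (0 - z)" using False c by (intro mult_nonneg_nonneg) auto
      then show ?thesis using lower[of z 0] upper[of z 0] False by (simp add: algebra_simps abs_if)
    qed
    also have "\<bar>\<sigma> * (\<psi> z - \<psi> 0)\<bar> = \<bar>\<psi> z - \<psi> 0\<bar>" using sign by (simp add: abs_mult)
    finally have "\<bar>\<psi> z - \<psi> 0\<bar> \<le> K * \<bar>z\<bar>" .
    moreover have "K * \<bar>z\<bar> \<le> K * R" using that K_pos by (intro mult_left_mono) auto
    ultimately show ?thesis by linarith
  qed
  have "norm (\<phi> s - \<phi> t) \<le> (\<bar>\<psi> 0\<bar> + K * R) * norm (s - t)"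
    using assms
    by (intro field_differentiable_bound[of "{-R..R}" \<phi> \<psi>]) (auto intro: has_field_derivative_at_within deriv \<psi>)
  then show ?thesis by simp
qed

lemma \<Phi>_lipschitz:
  assumes "bounded S"
  obtains L where "L-lipschitz_on S (\<Phi> \<alpha>)"
proof -
  obtain B where B: "\<And>e. e \<in> S \<Longrightarrow> norm e \<le> B" using assms bounded_iff by blast
  define R where "R = \<bar>B\<bar> + \<bar>\<alpha>\<bar>"
  define l where "l = \<bar>\<psi> 0\<bar> + K * R"
  have l0: "0 \<le> l" using K_pos by (simp add: l_def R_def)
  have "(1 + l)-lipschitz_on S (\<Phi> \<alpha>)"
  proof (rule lipschitz_onI)
    fix e e' assume e: "e \<in> S" "e' \<in> S"
    have n: "\<bar>fst x\<bar> \<le> norm x" for x :: "real \<times> real" using norm_fst_le[of "fst x" "snd x"] by simp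
    have "\<bar>\<phi> (fst e - \<alpha>) - \<phi> (fst e' - \<alpha>)\<bar> \<le> l * \<bar>(fst e - \<alpha>) - (fst e' - \<alpha>)\<bar>"
      unfolding l_def using n[of e] n[of e'] B[OF e(1)] B[OF e(2)] by (intro \<phi>_lipschitz) (auto simp: R_def)
    also have "\<dots> \<le> l * dist e e'"
      using dist_fst_le[of e e'] l0 by (intro mult_left_mono) (auto simp: dist_real_def)
    finally have "\<bar>\<phi> (fst e - \<alpha>) - \<phi> (fst e' - \<alpha>)\<bar> \<le> l * dist e e'" .
    then show "dist (\<Phi> \<alpha> e) (\<Phi> \<alpha> e') \<le> (1 + l) * dist e e'"
      using dist_snd_le[of e e'] by (simp add: \<Phi>_def dist_real_def algebra_simps)
  qed (use l0 in auto)
  then show ?thesis using that by blast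
qed

text \<open>
  The curve that becomes the graph \<open>u = g v\<close> in the coordinates \<open>u = fst e\<close>, \<open>v = \<Phi> \<alpha> e\<close>.
\<close>

lemma lipschitz_graph:
  fixes g :: "real \<Rightarrow> real"
  assumes g: "L-lipschitz_on UNIV g" and B: "\<And>t. \<bar>g t\<bar> \<le> B"
  shows "\<exists>M. M-lipschitz_on UNIV (\<lambda>t. (g t, t + \<phi> (g t - \<alpha>)))"
proof -
  define l where "l = \<bar>\<psi> 0\<bar> + K * (B + \<bar>\<alpha>\<bar>)"
  have B0: "0 \<le> B" using B[of 0] by linarith
  have l0: "0 \<le> l" using K_pos B0 by (simp add: l_def)
  have L0: "0 \<le> L" using g lipschitz_on_nonneg by blast
  have "(L + (1 + l * L))-lipschitz_on UNIV (\<lambda>t. (g t, t + \<phi> (g t - \<alpha>)))"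
  proof (rule lipschitz_onI)
    fix s t :: real
    have gst: "\<bar>g s - g t\<bar> \<le> L * \<bar>s - t\<bar>" using lipschitz_onD[OF g, of s t] by (simp add: dist_real_def)
    have "\<bar>\<phi> (g s - \<alpha>) - \<phi> (g t - \<alpha>)\<bar> \<le> l * \<bar>(g s - \<alpha>) - (g t - \<alpha>)\<bar>"
      unfolding l_def using B[of s] B[of t] by (intro \<phi>_lipschitz) auto
    also have "\<dots> \<le> l * (L * \<bar>s - t\<bar>)" using gst l0 by (intro mult_left_mono) auto
    finally have p: "\<bar>\<phi> (g s - \<alpha>) - \<phi> (g t - \<alpha>)\<bar> \<le> l * (L * \<bar>s - t\<bar>)" .
    have "dist (g s, s + \<phi> (g s - \<alpha>)) (g t, t + \<phi> (g t - \<alpha>))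
        \<le> \<bar>g s - g t\<bar> + \<bar>(s + \<phi> (g s - \<alpha>)) - (t + \<phi> (g t - \<alpha>))\<bar>"
      unfolding dist_Pair_Pair dist_real_def using sqrt_sum_squares_le_sum_abs[of "\<bar>g s - g t\<bar>"] by simp
    also have "\<dots> \<le> (L + (1 + l * L)) * \<bar>s - t\<bar>" using gst p by (simp add: algebra_simps)
    finally show "dist (g s, s + \<phi> (g s - \<alpha>)) (g t, t + \<phi> (g t - \<alpha>)) \<le> (L + (1 + l * L)) * dist s t"
      by (simp add: dist_real_def)
  qed (use L0 l0 in auto)
  then show ?thesis by blast
qed

end

section \<open>The projection theorem near isolated points\<close>

text \<open>
  McShane's extension \<open>t \<mapsto> inf (u a + L \<bar>t - v a\<bar>)\<close>, truncated to \<open>[-B, B]\<close>. The bound is needed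
  because \<open>\<phi>\<close> is Lipschitz only on bounded sets.
\<close>

lemma lipschitz_interpolation:
  fixes u v :: "'a \<Rightarrow> real"
  assumes L: "0 \<le> L" and lip: "\<And>a b. a \<in> A \<Longrightarrow> b \<in> A \<Longrightarrow> \<bar>u a - u b\<bar> \<le> L * \<bar>v a - v b\<bar>"
    and B: "0 \<le> B" "\<And>a. a \<in> A \<Longrightarrow> \<bar>u a\<bar> \<le> B"
  shows "\<exists>g. L-lipschitz_on UNIV g \<and> (\<forall>t. \<bar>g t\<bar> \<le> B) \<and> (\<forall>a\<in>A. g (v a) = u a)"
proof (cases "A = {}")
  case True
  then show ?thesis using L B by (intro exI[of _ "\<lambda>_. 0"]) (auto simp: lipschitz_on_def)
next
  case False
  define g0 where "g0 t = (INF a\<in>A. u a + L * \<bar>t - v a\<bar>)" for t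
  have bdd: "bdd_below ((\<lambda>a. u a + L * \<bar>t - v a\<bar>) ` A)" for t
  proof (rule bdd_belowI2)
    fix a assume "a \<in> A"
    then have "- B \<le> u a" using B(2)[of a] by (simp add: abs_le_iff)
    then show "- B \<le> u a + L * \<bar>t - v a\<bar>" using L by (simp add: add_increasing2)
  qed
  have g0le: "g0 s \<le> g0 t + L * \<bar>s - t\<bar>" for s t
  proof -
    have "g0 s - L * \<bar>s - t\<bar> \<le> u a + L * \<bar>t - v a\<bar>" if "a \<in> A" for a
    proof -
      have "g0 s \<le> u a + L * \<bar>s - v a\<bar>" unfolding g0_def by (rule cINF_lower[OF bdd that])
      also have "L * \<bar>s - v a\<bar> \<le> L * (\<bar>s - t\<bar> + \<bar>t - v a\<bar>)" using L by (intro mult_left_mono) auto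
      finally show ?thesis by (simp add: algebra_simps)
    qed
    then have "g0 s - L * \<bar>s - t\<bar> \<le> g0 t" unfolding g0_def[of t] by (intro cINF_greatest False)
    then show ?thesis by simp
  qed
  have g0v: "g0 (v a) = u a" if a: "a \<in> A" for a
  proof (rule antisym)
    show "g0 (v a) \<le> u a" unfolding g0_def using cINF_lower[OF bdd a, of "v a"] by simp
    show "u a \<le> g0 (v a)" unfolding g0_def
      using lip[OF a] by (intro cINF_greatest False) (smt (verit))
  qed
  define g where "g t = max (- B) (min B (g0 t))" for t
  show ?thesis
  proof (intro exI[of _ g] conjI allI ballI)
    show "L-lipschitz_on UNIV g"
    proof (rule lipschitz_onI[OF _ L])
      fix s t :: real
      have "\<bar>g s - g t\<bar> \<le> \<bar>g0 s - g0 t\<bar>" by (auto simp: g_def max_def min_def abs_if)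
      also have "\<dots> \<le> L * \<bar>s - t\<bar>" using g0le[of s t] g0le[of t s] by (simp add: abs_minus_commute abs_le_iff)
      finally show "dist (g s) (g t) \<le> L * dist s t" by (simp add: dist_real_def)
    qed
    show "\<bar>g t\<bar> \<le> B" for t using B(1) by (auto simp: g_def max_def min_def)
    show "g (v a) = u a" if "a \<in> A" for a using g0v[OF that] B(2)[OF that] by (auto simp: g_def max_def min_def)
  qed
qed

text \<open>
  Lower semicontinuity of the measure of the sections of an open set: a compact part of a section with
  measure above \<open>l\<close> stays inside the nearby sections by the tube lemma.
\<close>

lemma open_measure_section:
  fixes \<mu> :: "'b::{second_countable_topology, complete_space} measure" and O' :: "('a::topological_space \<times> 'b) set"
  assumes s: "sets \<mu> = sets borel" and fin: "finite_measure \<mu>" and O: "open O'"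
  shows "open {p. l < measure \<mu> (Pair p -` O')}"
proof (cases "0 \<le> l")
  case True
  interpret finite_measure \<mu> by fact
  show ?thesis
  proof (subst open_subopen, safe)
    fix p assume p: "l < measure \<mu> (Pair p -` O')"
    have op: "open (Pair p -` O')" using O by (intro open_vimage continuous_intros)
    have "ennreal l < emeasure \<mu> (Pair p -` O')"
      using p True by (simp add: emeasure_eq_measure ennreal_lessI)
    also have "\<dots> = (SUP C\<in>{C. C \<subseteq> Pair p -` O' \<and> compact C}. emeasure \<mu> C)"
      using op s by (intro inner_regular) auto
    finally obtain C where C: "C \<subseteq> Pair p -` O'" "compact C" "ennreal l < emeasure \<mu> C"
      unfolding less_SUP_iff by blast
    have "{p} \<times> C \<subseteq> O'" using C(1) by auto
    then obtain X where X: "p \<in> X" "open X" "X \<times> C \<subseteq> O'"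
      using Elementary_Topology.tube_lemma[OF C(2) O] by blast
    have "X \<subseteq> {p. l < measure \<mu> (Pair p -` O')}"
    proof clarify
      fix q assume "q \<in> X"
      then have "C \<subseteq> Pair q -` O'" using X by auto
      moreover have "Pair q -` O' \<in> sets \<mu>" unfolding s using O by (intro borel_open open_vimage continuous_intros)
      ultimately have "measure \<mu> C \<le> measure \<mu> (Pair q -` O')" by (intro finite_measure_mono)
      moreover have "l < measure \<mu> C" using C(3) True by (simp add: emeasure_eq_measure ennreal_less_iff)
      ultimately show "l < measure \<mu> (Pair q -` O')" by simp
    qed
    then show "\<exists>T. open T \<and> p \<in> T \<and> T \<subseteq> {p. l < measure \<mu> (Pair p -` O')}" using X by blast
  qed
next
  case False
  then have "{p. l < measure \<mu> (Pair p -` O')} = UNIV"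
    by (auto intro: less_le_trans[OF _ measure_nonneg])
  then show ?thesis by simp
qed

text \<open>
  The measure \<open>\<mu>\<close> is the length measure on \<open>E\<close>. It is a parameter of the locale and is supplied by
  \<open>hausdorff1_restricted_measure\<close>.
\<close>

locale curved_besicovitch = curved_projections +
  fixes E :: "(real \<times> real) set" and \<mu> :: "(real \<times> real) measure"
  assumes E: "compact E" and pu: "purely_unrectifiable E"
    and sets_\<mu> [measurable_cong]: "sets \<mu> = sets borel" and finite_\<mu>: "finite_measure \<mu>"
    and \<mu>_eq: "\<And>A. A \<in> sets borel \<Longrightarrow> emeasure \<mu> A = hausdorff1 (A \<inter> E)"
begin

sublocale finite_measure \<mu> by (rule finite_\<mu>)

definition sector :: "real \<times> real \<Rightarrow> real \<Rightarrow> real \<Rightarrow> real \<Rightarrow> (real \<times> real) set" where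
  "sector e \<alpha> r s = {e'. \<bar>fst e' - fst e\<bar> < r \<and> \<bar>\<Phi> \<alpha> e' - \<Phi> \<alpha> e\<bar> < s * \<bar>fst e' - fst e\<bar>}"

text \<open>
  The translate of the graph through \<open>e\<close> with parameter \<open>\<alpha>\<close> meets \<open>E\<close> only in \<open>e\<close>.
\<close>

definition isolated :: "((real \<times> real) \<times> real) set" where
  "isolated = {(e, \<alpha>). e \<in> E \<and> (\<forall>e'\<in>E. \<Phi> \<alpha> e' = \<Phi> \<alpha> e \<longrightarrow> e' = e)}"

definition bounded_sectors :: "real \<Rightarrow> ((real \<times> real) \<times> real) set" where
  "bounded_sectors M = {(e, \<alpha>). \<forall>r>0. \<forall>s>0. measure \<mu> (sector e \<alpha> r s) \<le> M * r * s}"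

text \<open>
  The bound \<open>\<epsilon> r s\<close> is required for all widths up to \<open>s0\<close>, not only for \<open>s0\<close> itself. This makes
  the sets increase when \<open>s0\<close> decreases.
\<close>

definition thin_to :: "real \<Rightarrow> real \<Rightarrow> ((real \<times> real) \<times> real) set" where
  "thin_to \<epsilon> s0 = {(e, \<alpha>). \<forall>r>0. \<forall>s\<in>{0<..s0}. measure \<mu> (sector e \<alpha> r s) \<le> \<epsilon> * r * s}"

definition thick :: "((real \<times> real) \<times> real) set" where
  "thick = - (\<Union>m. bounded_sectors (real m))"

text \<open>
  The ratio \<open>measure \<mu> (sector e \<alpha> r s) / (r s)\<close> tends to \<open>0\<close> for \<open>s \<longlonglongrightarrow> 0\<close>, uniformly in \<open>r\<close>.
\<close>

definition thin :: "((real \<times> real) \<times> real) set" where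
  "thin = (\<Inter>k. \<Union>n. thin_to (inverse (real (Suc k))) (inverse (real (Suc n))))"

lemma \<mu>_outside: "A \<in> sets borel \<Longrightarrow> emeasure \<mu> A = emeasure \<mu> (A \<inter> E)"
  using borel_compact[OF E] by (simp add: \<mu>_eq Int_assoc)

lemma sector_open: "open (sector e \<alpha> r s)"
  unfolding sector_def by (intro open_Collect_conj open_Collect_less continuous_intros)

lemma sector_sets [measurable]: "sector e \<alpha> r s \<in> sets \<mu>"
  unfolding sets_\<mu> by (intro borel_open sector_open)

lemma open_large_sectors: "open {(e, \<alpha>). l < measure \<mu> (sector e \<alpha> r s)}"
proof -
  let ?O = "{q :: ((real \<times> real) \<times> real) \<times> (real \<times> real). \<bar>fst (snd q) - fst (fst (fst q))\<bar> < r \<and>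
     \<bar>\<Phi> (snd (fst q)) (snd q) - \<Phi> (snd (fst q)) (fst (fst q))\<bar> < s * \<bar>fst (snd q) - fst (fst (fst q))\<bar>}"
  have "open ?O" by (intro open_Collect_conj open_Collect_less continuous_intros)
  from open_measure_section[OF sets_\<mu> finite_\<mu> this, of l]
  have "open {p. l < measure \<mu> (Pair p -` ?O)}" .
  moreover have "Pair p -` ?O = sector (fst p) (snd p) r s" for p
    by (auto simp: sector_def)
  ultimately show ?thesis by (simp add: case_prod_unfold)
qed

lemma thin_to_antimono: "s0 \<le> s1 \<Longrightarrow> thin_to \<epsilon> s1 \<subseteq> thin_to \<epsilon> s0"
  unfolding thin_to_def by clarsimp

lemma closed_small_sectors: "closed {(e, \<alpha>). measure \<mu> (sector e \<alpha> r s) \<le> l}"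
proof -
  have "- {(e, \<alpha>). measure \<mu> (sector e \<alpha> r s) \<le> l} = {(e, \<alpha>). l < measure \<mu> (sector e \<alpha> r s)}"
    by (auto simp: not_le)
  then show ?thesis unfolding closed_def using open_large_sectors[of l r s] by simp
qed

lemma closed_bounded_sectors: "closed (bounded_sectors M)"
proof -
  have "bounded_sectors M = (\<Inter>r\<in>{0<..}. \<Inter>s\<in>{0<..}. {(e, \<alpha>). measure \<mu> (sector e \<alpha> r s) \<le> M * r * s})"
    by (auto simp: bounded_sectors_def)
  then show ?thesis by (auto intro!: closed_INT closed_small_sectors)
qed

lemma closed_thin_to: "closed (thin_to \<epsilon> s0)"
proof -
  have "thin_to \<epsilon> s0 = (\<Inter>r\<in>{0<..}. \<Inter>s\<in>{0<..s0}. {(e, \<alpha>). measure \<mu> (sector e \<alpha> r s) \<le> \<epsilon> * r * s})"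
    by (auto simp: thin_to_def)
  then show ?thesis by (auto intro!: closed_INT closed_small_sectors)
qed

lemma borel_bounded_sectors [measurable]: "bounded_sectors M \<in> sets borel"
  using closed_bounded_sectors by (rule borel_closed)

lemma borel_thin_to [measurable]: "thin_to \<epsilon> s0 \<in> sets borel"
  using closed_thin_to by (rule borel_closed)

text \<open>
  Having a second point of the fibre at distance at least \<open>1/(n+1)\<close> is a closed condition, as the
  projection of a closed set along the compact set \<open>E\<close>.
\<close>

lemma borel_isolated [measurable]: "isolated \<in> sets borel"
proof -
  define N where "N n = {p. \<exists>e'. e' \<in> E \<and> (e', p) \<in> {q. \<Phi> (snd (snd q)) (fst q) = \<Phi> (snd (snd q)) (fst (snd q))
    \<and> inverse (real (Suc n)) \<le> dist (fst q) (fst (snd q))}}" for n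
  have "closed (N n)" for n unfolding N_def
    by (intro closed_compact_projection E closed_Collect_conj closed_Collect_eq closed_Collect_le continuous_intros)
  then have [measurable]: "N n \<in> sets borel" for n by (rule borel_closed)
  have "isolated = E \<times> UNIV - (\<Union>n. N n)"
  proof (intro set_eqI iffI)
    fix p assume "p \<in> isolated"
    then show "p \<in> E \<times> UNIV - (\<Union>n. N n)" by (auto simp: isolated_def N_def)
  next
    fix p assume p: "p \<in> E \<times> UNIV - (\<Union>n. N n)"
    have "e' = fst p" if "e' \<in> E" "\<Phi> (snd p) e' = \<Phi> (snd p) (fst p)" for e'
    proof (rule ccontr)
      assume "e' \<noteq> fst p"
      then obtain n where "inverse (real (Suc n)) < dist e' (fst p)"
        using reals_Archimedean[of "dist e' (fst p)"] by auto
      then have "p \<in> N n" using that by (auto simp del: split_paired_Ex simp: N_def intro!: exI[of _ e'])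
      then show False using p by blast
    qed
    then show "p \<in> isolated" using p by (auto simp: isolated_def)
  qed
  moreover have "E \<times> UNIV \<in> sets (borel :: ((real \<times> real) \<times> real) measure)"
    using E by (intro borel_closed closed_Times) (auto simp: compact_imp_closed)
  ultimately show ?thesis by auto
qed

lemma section_sets: "X \<in> sets borel \<Longrightarrow> {e. (e, \<alpha>) \<in> X} \<in> sets \<mu>"
proof -
  assume X: "X \<in> sets borel"
  have "(\<lambda>e. (e, \<alpha>)) \<in> borel_measurable borel"
    by (intro borel_measurable_continuous_onI continuous_intros)
  from measurable_sets[OF this X] show ?thesis by (simp add: sets_\<mu> vimage_def)
qed

lemma \<Phi>_measurable [measurable]: "\<Phi> \<alpha> \<in> borel_measurable \<mu>"
  unfolding measurable_cong_sets[OF sets_\<mu> refl]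
  by (intro borel_measurable_continuous_onI continuous_intros)

text \<open>
  Such a set lies on a Lipschitz curve, to which pure unrectifiability applies.
\<close>

lemma graph_null:
  assumes A0: "A0 \<subseteq> E" and s: "0 < s"
    and lip: "\<And>a b. a \<in> A0 \<Longrightarrow> b \<in> A0 \<Longrightarrow> s * \<bar>fst b - fst a\<bar> \<le> 4 * \<bar>\<Phi> \<alpha> b - \<Phi> \<alpha> a\<bar>"
  shows "\<exists>N\<in>null_sets \<mu>. A0 \<subseteq> N"
proof -
  obtain B where B: "0 < B" "\<And>e. e \<in> E \<Longrightarrow> norm e \<le> B"
    using compact_imp_bounded[OF E] bounded_pos by blast
  have fB: "\<bar>fst e\<bar> \<le> B" if "e \<in> A0" for e
    using norm_fst_le[of "fst e" "snd e"] B(2)[of e] A0 that by auto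
  have lipg: "\<bar>fst a - fst b\<bar> \<le> 4 / s * \<bar>\<Phi> \<alpha> a - \<Phi> \<alpha> b\<bar>" if "a \<in> A0" "b \<in> A0" for a b
    using lip[OF that(2,1)] s by (simp add: field_simps)
  have s4: "0 \<le> 4 / s" and B0: "0 \<le> B" using s B(1) by auto
  obtain g where g: "(4 / s)-lipschitz_on UNIV g" "\<And>t. \<bar>g t\<bar> \<le> B" "\<And>a. a \<in> A0 \<Longrightarrow> g (\<Phi> \<alpha> a) = fst a"
    using lipschitz_interpolation[where u = fst and v = "\<Phi> \<alpha>", OF s4 lipg B0 fB] by metis
  define f where "f = (\<lambda>t. (g t, t + \<phi> (g t - \<alpha>)))"
  obtain M where M: "M-lipschitz_on UNIV f" using lipschitz_graph[OF g(1,2)] unfolding f_def by blast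
  have "range f = (\<Union>n. f ` {- real n..real n})"
  proof -
    have "\<exists>n. t \<in> {- real n..real n}" for t :: real
    proof -
      obtain n where "\<bar>t\<bar> \<le> real n" using real_arch_simple by blast
      then show ?thesis by (intro exI[of _ n]) auto
    qed
    then have "(UNIV :: real set) = (\<Union>n. {- real n..real n})" by blast
    then show ?thesis by (metis image_UN)
  qed
  moreover have "f ` {- real n..real n} \<in> sets borel" for n
    using lipschitz_on_continuous_on[OF M] by (intro borel_compact compact_continuous_image) (auto intro: continuous_on_subset)
  ultimately have rf: "range f \<in> sets borel" by simp
  have "hausdorff1 (E \<inter> range f) = 0" using pu M unfolding purely_unrectifiable_def by blast
  then have "range f \<in> null_sets \<mu>" using rf \<mu>_eq[OF rf] by (intro null_setsI) (auto simp: sets_\<mu> Int_commute)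
  moreover have "A0 \<subseteq> range f"
  proof
    fix a assume a: "a \<in> A0"
    have "f (\<Phi> \<alpha> a) = a" using g(3)[OF a] by (simp add: f_def \<Phi>_def)
    then show "a \<in> range f" by (metis rangeI)
  qed
  ultimately show ?thesis by blast
qed

lemma negligible_image_of_null:
  assumes "A \<in> sets borel" "A \<subseteq> E" "emeasure \<mu> A = 0"
  shows "negligible (\<Phi> \<alpha> ` A)"
proof -
  have "bounded A" using assms(2) compact_imp_bounded[OF E] bounded_subset by blast
  then obtain L where "L-lipschitz_on A (\<Phi> \<alpha>)" using \<Phi>_lipschitz by blast
  moreover have "hausdorff1 A = 0" using assms \<mu>_eq[OF assms(1)] by (simp add: Int_absorb2)
  ultimately show ?thesis by (rule hausdorff1_null_imp_negligible_image)
qed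

text \<open>
  For each \<open>\<epsilon>\<close>, the points with sectors below \<open>\<epsilon> r s\<close> up to some width have measure \<open>O(\<epsilon>)\<close>: the bound
  of \<open>measure_le_of_thin_cones\<close> does not depend on the width, so it survives the increasing union over
  the widths.
\<close>

lemma thin_null: "emeasure \<mu> {e \<in> E. (e, \<alpha>) \<in> thin} = 0"
proof -
  obtain B0 where B0: "0 < B0" "\<And>e. e \<in> E \<Longrightarrow> norm e \<le> B0"
    using compact_imp_bounded[OF E] bounded_pos by blast
  have "compact (\<Phi> \<alpha> ` E)" using E by (intro compact_continuous_image continuous_intros)
  then obtain B1 where B1: "0 < B1" "\<And>e. e \<in> E \<Longrightarrow> \<bar>\<Phi> \<alpha> e\<bar> \<le> B1"
    using compact_imp_bounded bounded_pos by (metis imageI real_norm_def)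
  define B where "B = max B0 B1"
  have fB: "\<bar>fst e\<bar> \<le> B" if "e \<in> E" for e
    using norm_fst_le[of "fst e" "snd e"] B0(2)[OF that] by (auto simp: B_def)
  have vB: "\<bar>\<Phi> \<alpha> e\<bar> \<le> B" if "e \<in> E" for e using B1(2)[OF that] by (auto simp: B_def)
  have B: "0 < B" using B0 by (simp add: B_def)
  define A where "A k n = E \<inter> {e. (e, \<alpha>) \<in> thin_to (inverse (real (Suc k))) (inverse (real (Suc n)))}" for k n
  have Eb: "E \<in> sets \<mu>" using E by (simp add: sets_\<mu> borel_compact)
  have A [measurable]: "A k n \<in> sets \<mu>" for k n
    unfolding A_def using Eb by (intro sets.Int section_sets) auto
  have bnd: "measure \<mu> (A k n) \<le> 480 * inverse (real (Suc k)) * B" for k n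
  proof (rule measure_le_of_thin_cones[where u = fst and v = "\<Phi> \<alpha>" and s = "inverse (real (Suc n))"])
    show "fst \<in> borel_measurable \<mu>"
      unfolding measurable_cong_sets[OF sets_\<mu> refl] by (intro borel_measurable_continuous_onI continuous_intros)
    show "inverse (real (Suc n)) \<le> 1" by (simp add: inverse_le_1_iff)
    fix a and r :: real assume a: "a \<in> A k n" and r: "0 < r"
    have sp: "space \<mu> = UNIV" using sets_eq_imp_space_eq[OF sets_\<mu>] by simp
    have "measure \<mu> (sector a \<alpha> r (inverse (real (Suc n)))) \<le> inverse (real (Suc k)) * r * inverse (real (Suc n))"
      using a r by (auto simp: A_def thin_to_def)
    then show "measure \<mu> {b \<in> space \<mu>. \<bar>fst b - fst a\<bar> < r \<and> \<bar>\<Phi> \<alpha> b - \<Phi> \<alpha> a\<bar> < inverse (real (Suc n)) * \<bar>fst b - fst a\<bar>}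
       \<le> inverse (real (Suc k)) * r * inverse (real (Suc n))"
      by (simp add: sector_def sp)
  next
    fix A0 assume "A0 \<subseteq> A k n" and "\<And>a b. a \<in> A0 \<Longrightarrow> b \<in> A0 \<Longrightarrow>
      inverse (real (Suc n)) * \<bar>fst b - fst a\<bar> \<le> 4 * \<bar>\<Phi> \<alpha> b - \<Phi> \<alpha> a\<bar>"
    then show "\<exists>N\<in>null_sets \<mu>. A0 \<subseteq> N"
      by (intro graph_null[of A0 "inverse (real (Suc n))" \<alpha>]) (auto simp: A_def)
  next
    show "\<bar>fst a\<bar> \<le> B" "\<bar>\<Phi> \<alpha> a\<bar> \<le> B" if "a \<in> A k n" for a using that fB vB by (auto simp: A_def)
  qed (use B finite_\<mu> A in auto)
  have inc: "incseq (A k)" for k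
  proof (rule incseq_SucI)
    fix n
    have "inverse (real (Suc (Suc n))) \<le> inverse (real (Suc n))" by (intro le_imp_inverse_le) auto
    from thin_to_antimono[OF this] show "A k n \<subseteq> A k (Suc n)" unfolding A_def by blast
  qed
  have U: "measure \<mu> (\<Union>n. A k n) \<le> 480 * inverse (real (Suc k)) * B" for k
  proof -
    have "range (A k) \<subseteq> sets \<mu>" using A by auto
    from LIMSEQ_le_const2[OF finite_Lim_measure_incseq[OF this inc]] show ?thesis using bnd[of k] by blast
  qed
  let ?T = "{e \<in> E. (e, \<alpha>) \<in> thin}"
  have T: "?T = (\<Inter>k. \<Union>n. A k n)" unfolding thin_def A_def by auto
  have le: "measure \<mu> ?T \<le> 480 * B * inverse (real (Suc k))" for k
  proof -
    have "measure \<mu> ?T \<le> measure \<mu> (\<Union>n. A k n)" unfolding T by (intro finite_measure_mono) auto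
    then show ?thesis using U[of k] by (simp add: mult_ac)
  qed
  have "(\<lambda>k. 480 * B * inverse (real (Suc k))) \<longlonglongrightarrow> 480 * B * 0"
    by (intro tendsto_mult tendsto_const LIMSEQ_inverse_real_of_nat)
  then have "measure \<mu> ?T \<le> 0" using le by (intro LIMSEQ_le_const) auto
  then have "measure \<mu> ?T = 0" using measure_nonneg[of \<mu> ?T] by linarith
  then show ?thesis by (simp add: emeasure_eq_measure)
qed

text \<open>
  A sector of length \<open>r\<close> and width \<open>s\<close> is projected into the ball of radius \<open>r s\<close> around \<open>\<Phi> \<alpha> e\<close>.
\<close>

lemma negligible_thick_image: "negligible (\<Phi> \<alpha> ` {e. (e, \<alpha>) \<in> thick})"
proof -
  define \<kappa> where "\<kappa> = distr \<mu> borel (\<Phi> \<alpha>)"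
  have fin: "finite_measure \<kappa>" unfolding \<kappa>_def by (rule finite_measure_distr) simp
  have "negligible {t. \<forall>M>0. \<exists>\<rho>>0. M * \<rho> < measure \<kappa> (ball t \<rho>)}"
    using fin by (intro negligible_infinite_maximal_density) (auto simp: \<kappa>_def)
  moreover have "\<Phi> \<alpha> ` {e. (e, \<alpha>) \<in> thick} \<subseteq> {t. \<forall>M>0. \<exists>\<rho>>0. M * \<rho> < measure \<kappa> (ball t \<rho>)}"
  proof clarify
    fix e and M :: real assume e: "(e, \<alpha>) \<in> thick" and M: "0 < M"
    obtain m where m: "M \<le> real m" using real_arch_simple by blast
    have "(e, \<alpha>) \<notin> bounded_sectors (real m)" using e by (auto simp: thick_def)
    then obtain r s where rs: "0 < r" "0 < s" "real m * r * s < measure \<mu> (sector e \<alpha> r s)"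
      unfolding bounded_sectors_def by (auto simp: not_le)
    have "M * (r * s) \<le> real m * (r * s)" using m rs by (intro mult_right_mono) auto
    moreover have "measure \<mu> (sector e \<alpha> r s) \<le> measure \<kappa> (ball (\<Phi> \<alpha> e) (r * s))"
    proof -
      have "sector e \<alpha> r s \<subseteq> \<Phi> \<alpha> -` ball (\<Phi> \<alpha> e) (r * s) \<inter> space \<mu>"
      proof
        fix e' assume "e' \<in> sector e \<alpha> r s"
        then have c: "\<bar>fst e' - fst e\<bar> < r" "\<bar>\<Phi> \<alpha> e' - \<Phi> \<alpha> e\<bar> < s * \<bar>fst e' - fst e\<bar>" by (auto simp: sector_def)
        have "s * \<bar>fst e' - fst e\<bar> \<le> s * r" using c rs by (intro mult_left_mono) auto
        then show "e' \<in> \<Phi> \<alpha> -` ball (\<Phi> \<alpha> e) (r * s) \<inter> space \<mu>"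
          using c sets_eq_imp_space_eq[OF sets_\<mu>] by (auto simp: dist_real_def mult.commute)
      qed
      then show ?thesis unfolding \<kappa>_def by (subst measure_distr) (auto intro!: finite_measure_mono)
    qed
    ultimately have "M * (r * s) < measure \<kappa> (ball (\<Phi> \<alpha> e) (r * s))"
      using rs(3) unfolding mult.assoc by linarith
    then show "\<exists>\<rho>>0. M * \<rho> < measure \<kappa> (ball (\<Phi> \<alpha> e) \<rho>)"
      using rs by (intro exI[of _ "r * s"]) auto
  qed
  ultimately show ?thesis by (rule negligible_subset)
qed

text \<open>
  A point of the sector is seen from \<open>e\<close> under a parameter \<open>a e'\<close> within \<open>s / c\<close> of \<open>\<alpha>\<close>, and this
  parameter lies in a gap of \<open>T\<close>, because for parameters in \<open>T\<close> the point \<open>e\<close> is alone in its fibre. The part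
  of the sector seen under parameters at distance of order \<open>d\<close> from a parameter \<open>t\<close> in a gap, where \<open>d\<close> is
  the distance from \<open>t\<close> to \<open>T\<close>, lies in a sector about the nearest parameter of \<open>T\<close> whose width is of order
  \<open>d\<close>, and this has measure at most of order \<open>M r d\<close>. Covering the gaps by such intervals gives the claim.
\<close>

lemma sector_measure_le_gap:
  assumes KI: "\<And>t. t \<in> T \<Longrightarrow> (e, t) \<in> isolated \<inter> bounded_sectors M" and T: "compact T" and \<alpha>: "\<alpha> \<in> T"
    and M: "0 \<le> M" and r: "0 < r" and s: "0 < s"
  shows "emeasure \<mu> (sector e \<alpha> r s) \<le> ennreal (7 / 2 * K * M * r) * emeasure lborel (ball \<alpha> (2 * s / c) - T)"
proof -
  have eE: "e \<in> E" using KI[OF \<alpha>] by (simp add: isolated_def)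
  define X where "X = sector e \<alpha> r s \<inter> E"
  have ne: "fst e' \<noteq> fst e" if "e' \<in> X" for e'
  proof
    assume "fst e' = fst e"
    then show False using that by (simp add: X_def sector_def)
  qed
  have "\<forall>e'\<in>X. \<exists>a. \<forall>t. c * \<bar>fst e' - fst e\<bar> * \<bar>t - a\<bar> \<le> \<bar>\<Phi> t e' - \<Phi> t e\<bar> \<and>
      \<bar>\<Phi> t e' - \<Phi> t e\<bar> \<le> K * \<bar>fst e' - fst e\<bar> * \<bar>t - a\<bar>"
  proof
    fix e' assume "e' \<in> X"
    then have "fst e \<noteq> fst e'" using ne by metis
    then show "\<exists>a. \<forall>t. c * \<bar>fst e' - fst e\<bar> * \<bar>t - a\<bar> \<le> \<bar>\<Phi> t e' - \<Phi> t e\<bar> \<and>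
      \<bar>\<Phi> t e' - \<Phi> t e\<bar> \<le> K * \<bar>fst e' - fst e\<bar> * \<bar>t - a\<bar>"
      by (rule transversality) blast
  qed
  from bchoice[OF this] obtain a where
    a_lo: "\<And>e' t. e' \<in> X \<Longrightarrow> c * \<bar>fst e' - fst e\<bar> * \<bar>t - a e'\<bar> \<le> \<bar>\<Phi> t e' - \<Phi> t e\<bar>" and
    a_hi: "\<And>e' t. e' \<in> X \<Longrightarrow> \<bar>\<Phi> t e' - \<Phi> t e\<bar> \<le> K * \<bar>fst e' - fst e\<bar> * \<bar>t - a e'\<bar>" by blast
  have w: "0 < \<bar>fst e' - fst e\<bar>" if "e' \<in> X" for e' using ne[OF that] by simp
  have near: "\<bar>\<alpha> - a e'\<bar> < s / c" if "e' \<in> X" for e'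
  proof -
    have "c * \<bar>fst e' - fst e\<bar> * \<bar>\<alpha> - a e'\<bar> < s * \<bar>fst e' - fst e\<bar>"
      using a_lo[OF that, of \<alpha>] that by (auto simp: X_def sector_def)
    then have "\<bar>fst e' - fst e\<bar> * (c * \<bar>\<alpha> - a e'\<bar>) < \<bar>fst e' - fst e\<bar> * s" by (simp add: mult_ac)
    then have "c * \<bar>\<alpha> - a e'\<bar> < s" using w[OF that] by simp
    then show ?thesis using c by (simp add: field_simps)
  qed
  have aT: "a e' \<notin> T" if "e' \<in> X" for e'
  proof
    assume "a e' \<in> T"
    then have "(e, a e') \<in> isolated" using KI by blast
    moreover have "\<Phi> (a e') e' = \<Phi> (a e') e" using a_hi[OF that, of "a e'"] by simp
    ultimately have "e' = e" using that by (auto simp: isolated_def X_def)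
    then show False using ne[OF that] by simp
  qed
  define V where "V = a ` X"
  define d where "d t = infdist t T" for t
  have Tne: "T \<noteq> {}" using \<alpha> by auto
  have "\<forall>t. \<exists>k\<in>T. d t = dist t k"
    unfolding d_def using infdist_attains_inf[OF compact_imp_closed[OF T] Tne] by metis
  then obtain k where k: "\<And>t. k t \<in> T" "\<And>t. d t = dist t (k t)" by metis
  have V: "t \<notin> T" "\<bar>\<alpha> - t\<bar> < s / c" if "t \<in> V" for t using that aT near by (auto simp: V_def)
  have d0: "0 < d t" if "t \<in> V" for t
    using V(1)[OF that] k(1)[of t] k(2)[of t] by (metis zero_less_dist_iff)
  have d1: "d t < s / c" if "t \<in> V" for t
    using V(2)[OF that] infdist_le[OF \<alpha>, of t] by (simp add: d_def dist_real_def abs_minus_commute)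
  define D where "D t = sector e (k t) r (7 * K * d t)" for t
  have gap: "ball t (d t) \<inter> (ball \<alpha> (2 * s / c) - T) = ball t (d t)" if "t \<in> V" for t
  proof -
    have "x \<in> ball \<alpha> (2 * s / c) - T" if x: "x \<in> ball t (d t)" for x
    proof
      have "\<bar>\<alpha> - x\<bar> \<le> \<bar>\<alpha> - t\<bar> + \<bar>t - x\<bar>" by simp
      also have "\<dots> < s / c + s / c" using V(2)[OF \<open>t \<in> V\<close>] d1[OF \<open>t \<in> V\<close>] x by (intro add_strict_mono) (auto simp: dist_real_def)
      finally show "x \<in> ball \<alpha> (2 * s / c)" by (simp add: dist_real_def)
      show "x \<notin> T" using infdist_le[of x T t] x by (auto simp: d_def)
    qed
    then show ?thesis by blast
  qed
  have "\<exists>C\<subseteq>V. V \<subseteq> (\<Union>t\<in>C. cball t (5 * d t)) \<and> (\<Union>t\<in>C. D t) \<in> sets \<mu> \<and>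
    emeasure \<mu> (\<Union>t\<in>C. D t) \<le> ennreal (7 / 2 * K * M * r) * emeasure lborel (ball \<alpha> (2 * s / c) - T)"
  proof (rule vitali_comparison[of V d "s / c" lborel "ball \<alpha> (2 * s / c) - T" D \<mu> "ennreal (7 / 2 * K * M * r)"])
    fix t assume t: "t \<in> V"
    show "0 < d t \<and> d t \<le> s / c" using d0[OF t] d1[OF t] by simp
    have "measure \<mu> (D t) \<le> M * r * (7 * K * d t)"
      using KI[OF k(1)[of t]] r d0[OF t] K_pos unfolding D_def bounded_sectors_def by auto
    moreover have "emeasure lborel (ball t (d t)) = ennreal (2 * d t)"
      using d0[OF t] by (simp add: ball_eq_greaterThanLessThan)
    ultimately show "emeasure \<mu> (D t) \<le> ennreal (7 / 2 * K * M * r) * emeasure lborel (ball t (d t) \<inter> (ball \<alpha> (2 * s / c) - T))"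
      unfolding gap[OF t] using d0[OF t] K_pos M r
      by (simp add: emeasure_eq_measure ennreal_mult[symmetric] ennreal_leI mult_ac)
    show "D t \<in> sets \<mu>" unfolding D_def by simp
  next
    show "ball \<alpha> (2 * s / c) - T \<in> sets borel" using T by (intro sets.Diff) (auto simp: borel_compact)
  qed simp
  then obtain C where C: "C \<subseteq> V" "V \<subseteq> (\<Union>t\<in>C. cball t (5 * d t))" "(\<Union>t\<in>C. D t) \<in> sets \<mu>"
    "emeasure \<mu> (\<Union>t\<in>C. D t) \<le> ennreal (7 / 2 * K * M * r) * emeasure lborel (ball \<alpha> (2 * s / c) - T)"
    by blast
  have "X \<subseteq> (\<Union>t\<in>C. D t)"
  proof
    fix e' assume e': "e' \<in> X"
    then have "a e' \<in> V" by (simp add: V_def)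
    then obtain t where t: "t \<in> C" "a e' \<in> cball t (5 * d t)" using C(2) by blast
    have tV: "t \<in> V" using t C(1) by blast
    have "\<bar>k t - a e'\<bar> \<le> \<bar>t - k t\<bar> + \<bar>t - a e'\<bar>" by simp
    also have "\<dots> \<le> d t + 5 * d t" using t(2) k(2)[of t] by (intro add_mono) (auto simp: dist_real_def)
    also have "\<dots> < 7 * d t" using d0[OF tV] by simp
    finally have "\<bar>k t - a e'\<bar> < 7 * d t" .
    then have "K * \<bar>fst e' - fst e\<bar> * \<bar>k t - a e'\<bar> < K * \<bar>fst e' - fst e\<bar> * (7 * d t)"
      using K_pos w[OF e'] by (intro mult_strict_left_mono) auto
    with a_hi[OF e', of "k t"] have "\<bar>\<Phi> (k t) e' - \<Phi> (k t) e\<bar> < 7 * K * d t * \<bar>fst e' - fst e\<bar>"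
      by (simp add: mult_ac)
    moreover have "\<bar>fst e' - fst e\<bar> < r" using e' by (simp add: X_def sector_def)
    ultimately have "e' \<in> D t" by (simp add: D_def sector_def)
    then show "e' \<in> (\<Union>t\<in>C. D t)" using t by blast
  qed
  then have "emeasure \<mu> X \<le> emeasure \<mu> (\<Union>t\<in>C. D t)" using C(3) by (rule emeasure_mono)
  moreover have "emeasure \<mu> (sector e \<alpha> r s) = emeasure \<mu> X"
    unfolding X_def by (rule \<mu>_outside) (intro borel_open sector_open)
  ultimately show ?thesis using C(4) by simp
qed

text \<open>
  Where the sectors are bounded but not thin, \<open>sector_measure_le_gap\<close> makes \<open>T\<close> porous at every point.
\<close>

lemma dichotomy_compact:
  assumes T: "compact T"
    and sub: "\<And>t. t \<in> T \<Longrightarrow> (e, t) \<in> isolated \<inter> bounded_sectors M \<and> (\<forall>n. (e, t) \<notin> thin_to \<epsilon> (inverse (real (Suc n))))"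
    and M: "0 < M" and \<epsilon>: "0 < \<epsilon>"
  shows "emeasure lborel T = 0"
proof (rule null_if_porous[OF T])
  define q where "q = \<epsilon> * c / (7 * K * M)"
  show "0 < q" using \<epsilon> c K_pos M by (simp add: q_def)
  fix \<alpha> \<eta> :: real assume \<alpha>: "\<alpha> \<in> T" and \<eta>: "0 < \<eta>"
  have "0 < \<eta> * c / 2" using \<eta> c by simp
  then obtain n where n: "inverse (real (Suc n)) < \<eta> * c / 2" using reals_Archimedean by blast
  have "(e, \<alpha>) \<notin> thin_to \<epsilon> (inverse (real (Suc n)))" using sub[OF \<alpha>] by blast
  then obtain r s where rs: "0 < r" "0 < s" "s \<le> inverse (real (Suc n))" "\<epsilon> * r * s < measure \<mu> (sector e \<alpha> r s)"
    unfolding thin_to_def by (auto simp: not_le)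
  define \<rho> where "\<rho> = 2 * s / c"
  have "s < \<eta> * c / 2" using rs(3) n by linarith
  then have "\<rho> < \<eta>" using c by (simp add: \<rho>_def field_simps)
  moreover have "0 < \<rho>" using rs c by (simp add: \<rho>_def)
  moreover have "ennreal (q * \<rho>) \<le> emeasure lborel (ball \<alpha> \<rho> - T)"
  proof -
    have "emeasure lborel (ball \<alpha> \<rho> - T) \<le> emeasure lborel (ball \<alpha> \<rho>)"
      using T by (intro emeasure_mono) (auto simp: borel_compact)
    also have "\<dots> < \<infinity>" using \<open>0 < \<rho>\<close> by (simp add: ball_eq_greaterThanLessThan)
    finally have gfin: "emeasure lborel (ball \<alpha> \<rho> - T) \<noteq> \<infinity>" by simp
    define g where "g = measure lborel (ball \<alpha> \<rho> - T)"
    have g: "0 \<le> g" "emeasure lborel (ball \<alpha> \<rho> - T) = ennreal g"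
      using gfin by (simp_all add: g_def emeasure_eq_ennreal_measure)
    have "emeasure \<mu> (sector e \<alpha> r s) \<le> ennreal (7 / 2 * K * M * r) * ennreal g"
      unfolding g(2)[symmetric] \<rho>_def
      by (rule sector_measure_le_gap[OF _ T \<alpha>]) (use sub M rs in auto)
    then have "ennreal (measure \<mu> (sector e \<alpha> r s)) \<le> ennreal (7 / 2 * K * M * r) * ennreal g"
      by (simp add: emeasure_eq_measure)
    then have "measure \<mu> (sector e \<alpha> r s) \<le> 7 / 2 * K * M * r * g"
      using g(1) K_pos M rs by (simp add: ennreal_mult[symmetric])
    then have "r * (\<epsilon> * s) \<le> r * (7 / 2 * K * M * g)" using rs(4) by (simp add: mult_ac)
    then have "\<epsilon> * s \<le> 7 / 2 * K * M * g" using rs(1) by simp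
    then have "q * \<rho> \<le> g" using K_pos M c by (simp add: q_def \<rho>_def field_simps)
    then show ?thesis using g by (simp add: ennreal_leI)
  qed
  ultimately show "\<exists>\<rho>>0. \<rho> < \<eta> \<and> ennreal (q * \<rho>) \<le> emeasure lborel (ball \<alpha> \<rho> - T)"
    by (intro exI[of _ \<rho>] conjI)
qed

text \<open>
  The exceptional parameters form countably many Borel sets, to whose compact subsets \<open>dichotomy_compact\<close>
  applies.
\<close>

lemma dichotomy: "AE \<alpha> in lborel. (e, \<alpha>) \<in> isolated \<longrightarrow> (e, \<alpha>) \<in> thick \<union> thin"
proof -
  define Q where "Q m k = {\<alpha>. (e, \<alpha>) \<in> isolated \<inter> bounded_sectors (real m) \<and>
     (\<forall>n. (e, \<alpha>) \<notin> thin_to (inverse (real (Suc k))) (inverse (real (Suc n))))}" for m k :: nat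
  have sec: "{\<alpha>. (e, \<alpha>) \<in> X} \<in> sets borel" if "X \<in> sets borel" for X :: "((real \<times> real) \<times> real) set"
  proof -
    have "Pair e \<in> borel_measurable (borel :: real measure)"
      by (intro borel_measurable_continuous_onI continuous_intros)
    from measurable_sets[OF this that] show ?thesis by (simp add: vimage_def)
  qed
  have Q: "Q m k \<in> sets borel" for m k
  proof -
    have "Q m k = {\<alpha>. (e, \<alpha>) \<in> isolated \<inter> bounded_sectors (real m) -
       (\<Union>n. thin_to (inverse (real (Suc k))) (inverse (real (Suc n))))}" by (auto simp: Q_def)
    then show ?thesis using sec by simp
  qed
  have null: "emeasure lborel (Q m k) = 0" for m k
  proof (rule lborel_null_if_compact_subsets_null[OF Q])
    fix T assume T: "compact T" "T \<subseteq> Q m k"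
    \<comment> \<open>The bound is enlarged to a positive one, since \<open>m\<close> may be \<open>0\<close>.\<close>
    have "measure \<mu> (sector a b r s) \<le> real (Suc m) * r * s"
      if "0 < r" "0 < s" "measure \<mu> (sector a b r s) \<le> real m * r * s" for a b r s
    proof -
      have "real m * (r * s) \<le> real (Suc m) * (r * s)" using that by (intro mult_right_mono) auto
      then show ?thesis using that(3) unfolding mult.assoc by linarith
    qed
    then have "bounded_sectors (real m) \<subseteq> bounded_sectors (real (Suc m))" unfolding bounded_sectors_def by auto
    then show "emeasure lborel T = 0" using T(2)
      by (intro dichotomy_compact[OF T(1), of e "real (Suc m)" "inverse (real (Suc k))"]) (auto simp: Q_def)
  qed
  have "(\<Union>m. \<Union>k. Q m k) \<in> null_sets lborel"
    using null Q by (intro null_sets_UN null_setsI) auto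
  then show ?thesis
  proof (rule AE_I')
    show "{\<alpha> \<in> space lborel. \<not> ((e, \<alpha>) \<in> isolated \<longrightarrow> (e, \<alpha>) \<in> thick \<union> thin)} \<subseteq> (\<Union>m. \<Union>k. Q m k)"
      unfolding thick_def thin_def Q_def by auto
  qed
qed

text \<open>
  The set \<open>bad\<close> of pairs outside the alternative is Borel, so Fubini's theorem exchanges the roles of \<open>e\<close>
  and \<open>\<alpha>\<close> in \<open>dichotomy\<close>.
\<close>

theorem AE_negligible_isolated_image:
  "AE \<alpha> in lborel. negligible (\<Phi> \<alpha> ` {e. (e, \<alpha>) \<in> isolated})"
proof -
  interpret P: pair_sigma_finite \<mu> "lborel :: real measure"
    by (intro pair_sigma_finite.intro sigma_finite_measure_axioms lborel.sigma_finite_measure_axioms)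
  define bad where "bad = isolated - (thick \<union> thin)"
  have bad: "bad \<in> sets borel" unfolding bad_def thick_def thin_def by measurable
  have "sets (\<mu> \<Otimes>\<^sub>M lborel) = sets ((borel :: (real \<times> real) measure) \<Otimes>\<^sub>M (borel :: real measure))"
    by (intro sets_pair_measure_cong) (auto simp: sets_\<mu>)
  then have spm: "sets (\<mu> \<Otimes>\<^sub>M lborel) = sets (borel :: ((real \<times> real) \<times> real) measure)"
    by (simp only: borel_prod)
  have sp: "space (\<mu> \<Otimes>\<^sub>M (lborel :: real measure)) = UNIV" using sets_eq_imp_space_eq[OF spm] by simp
  have "AE e in \<mu>. AE \<alpha> in lborel. (e, \<alpha>) \<notin> bad"
  proof (rule AE_I2)
    fix e show "AE \<alpha> in lborel. (e, \<alpha>) \<notin> bad"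
      using dichotomy[of e] by (rule eventually_mono) (auto simp: bad_def)
  qed
  moreover have "{x \<in> space (\<mu> \<Otimes>\<^sub>M lborel). (fst x, snd x) \<notin> bad} \<in> sets (\<mu> \<Otimes>\<^sub>M (lborel :: real measure))"
  proof -
    have "{x \<in> space (\<mu> \<Otimes>\<^sub>M (lborel :: real measure)). (fst x, snd x) \<notin> bad} = - bad" using sp by auto
    then show ?thesis unfolding spm using bad by simp
  qed
  ultimately have "AE \<alpha> in lborel. AE e in \<mu>. (e, \<alpha>) \<notin> bad"
    by (subst (asm) P.AE_commute)
  then show ?thesis
  proof (rule AE_mp, intro AE_I2 impI)
    fix \<alpha> assume ae: "AE e in \<mu>. (e, \<alpha>) \<notin> bad"
    have bs: "{e. (e, \<alpha>) \<in> bad} \<in> sets \<mu>" by (rule section_sets[OF bad])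
    have spmu: "space \<mu> = UNIV" using sets_eq_imp_space_eq[OF sets_\<mu>] by simp
    have b0: "emeasure \<mu> {e. (e, \<alpha>) \<in> bad} = 0"
      using ae bs by (subst (asm) AE_iff_measurable[OF bs]) (auto simp: spmu)
    have bE: "{e. (e, \<alpha>) \<in> bad} \<subseteq> E" by (auto simp: bad_def isolated_def)
    have "negligible (\<Phi> \<alpha> ` {e. (e, \<alpha>) \<in> bad})"
      using bs b0 bE by (intro negligible_image_of_null) (auto simp: sets_\<mu>)
    moreover have "negligible (\<Phi> \<alpha> ` {e \<in> E. (e, \<alpha>) \<in> thin})"
    proof (intro negligible_image_of_null thin_null)
      have "{e \<in> E. (e, \<alpha>) \<in> thin} = E \<inter> {e. (e, \<alpha>) \<in> thin}" by auto
      also have "\<dots> \<in> sets \<mu>" using E unfolding thin_def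
        by (intro sets.Int section_sets) (auto simp: sets_\<mu> borel_compact)
      finally show "{e \<in> E. (e, \<alpha>) \<in> thin} \<in> sets borel" by (simp add: sets_\<mu>)
    qed auto
    moreover have "\<Phi> \<alpha> ` {e. (e, \<alpha>) \<in> isolated} \<subseteq> \<Phi> \<alpha> ` {e. (e, \<alpha>) \<in> bad} \<union>
      (\<Phi> \<alpha> ` {e \<in> E. (e, \<alpha>) \<in> thin} \<union> \<Phi> \<alpha> ` {e. (e, \<alpha>) \<in> thick})"
      by (auto simp: bad_def isolated_def)
    ultimately show "negligible (\<Phi> \<alpha> ` {e. (e, \<alpha>) \<in> isolated})"
      using negligible_thick_image[of \<alpha>] by (meson negligible_Un negligible_subset)
  qed
qed

end

section \<open>The projection theorem and the Favard sets of graphs\<close>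

lemma purely_unrectifiable_subset:
  assumes E: "purely_unrectifiable E" and A: "A \<subseteq> E"
  shows "purely_unrectifiable A"
  unfolding purely_unrectifiable_def
proof (intro allI impI)
  fix f :: "real \<Rightarrow> real \<times> real" assume "\<exists>L. L-lipschitz_on UNIV f"
  then have "hausdorff1 (E \<inter> range f) = 0" using E unfolding purely_unrectifiable_def by blast
  moreover have "hausdorff1 (A \<inter> range f) \<le> hausdorff1 (E \<inter> range f)"
    using A by (intro hausdorff1_mono) auto
  ultimately show "hausdorff1 (A \<inter> range f) = 0" by simp
qed

context curved_projections
begin

lemma AE_negligible_unique_points:
  assumes E: "compact E" "hausdorff1 E < \<infinity>" "purely_unrectifiable E"
  shows "AE \<alpha> in lborel. negligible (\<Phi> \<alpha> ` {e \<in> E. \<forall>e'\<in>E. \<Phi> \<alpha> e' = \<Phi> \<alpha> e \<longrightarrow> e' = e})"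
proof (rule hausdorff1_restricted_measure[OF E(2)])
  fix \<mu> assume \<mu>: "sets \<mu> = sets borel" "finite_measure \<mu>"
    "\<And>A. A \<in> sets borel \<Longrightarrow> emeasure \<mu> A = hausdorff1 (A \<inter> E)"
  interpret curved_besicovitch \<phi> \<psi> \<sigma> c K E \<mu>
    by (intro curved_besicovitch.intro curved_besicovitch_axioms.intro curved_projections_axioms E \<mu>)
  show ?thesis using AE_negligible_isolated_image unfolding isolated_def mem_Collect_eq case_prod_conv .
qed

text \<open>
  A point of a finite fibre is alone in its fibre within \<open>E \<inter> closure b\<close> for some \<open>b\<close> in a countable basis, so
  countably many applications of \<open>AE_negligible_unique_points\<close> cover all finite fibres.
\<close>

theorem AE_negligible_image:
  assumes E: "compact E" "hausdorff1 E < \<infinity>" "purely_unrectifiable E"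
  shows "AE \<alpha> in lborel. negligible (\<Phi> \<alpha> ` E)"
proof -
  obtain B :: "(real \<times> real) set set" where B: "countable B" "topological_basis B"
    using ex_countable_basis by blast
  define U where "U b \<alpha> = {e \<in> E \<inter> closure b. \<forall>e'\<in>E \<inter> closure b. \<Phi> \<alpha> e' = \<Phi> \<alpha> e \<longrightarrow> e' = e}" for b \<alpha>
  have "AE \<alpha> in lborel. negligible (\<Phi> \<alpha> ` U b \<alpha>)" for b
    unfolding U_def
  proof (rule AE_negligible_unique_points)
    show "compact (E \<inter> closure b)" using E(1) by (intro compact_Int_closed) auto
    show "hausdorff1 (E \<inter> closure b) < \<infinity>" using hausdorff1_mono[of "E \<inter> closure b" E] E(2) by auto
    show "purely_unrectifiable (E \<inter> closure b)" using purely_unrectifiable_subset[OF E(3)] by auto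
  qed
  then have "AE \<alpha> in lborel. \<forall>b\<in>B. negligible (\<Phi> \<alpha> ` U b \<alpha>)"
    using B(1) by (intro AE_ball_countable') auto
  then show ?thesis
  proof (rule eventually_mono)
    fix \<alpha> assume neg: "\<forall>b\<in>B. negligible (\<Phi> \<alpha> ` U b \<alpha>)"
    obtain L where "L-lipschitz_on E (\<Phi> \<alpha>)" using \<Phi>_lipschitz compact_imp_bounded[OF E(1)] by blast
    then have inf: "negligible {\<beta>. infinite {e \<in> E. \<Phi> \<alpha> e = \<beta>}}"
      using E(2) by (intro negligible_infinite_fibres)
    have un: "negligible (\<Union>b\<in>B. \<Phi> \<alpha> ` U b \<alpha>)"
      using B(1) neg by (intro negligible_countable_Union) auto
    have "\<Phi> \<alpha> ` E \<subseteq> {\<beta>. infinite {e \<in> E. \<Phi> \<alpha> e = \<beta>}} \<union> (\<Union>b\<in>B. \<Phi> \<alpha> ` U b \<alpha>)"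
    proof
      fix \<beta> assume "\<beta> \<in> \<Phi> \<alpha> ` E"
      then obtain e where e: "e \<in> E" and \<beta>: "\<beta> = \<Phi> \<alpha> e" by blast
      have "infinite {e' \<in> E. \<Phi> \<alpha> e' = \<Phi> \<alpha> e}" if no: "\<Phi> \<alpha> e \<notin> (\<Union>b\<in>B. \<Phi> \<alpha> ` U b \<alpha>)"
      proof
        assume fin: "finite {e' \<in> E. \<Phi> \<alpha> e' = \<Phi> \<alpha> e}"
        obtain \<eta> where \<eta>: "0 < \<eta>" "\<And>x y. x \<in> {e' \<in> E. \<Phi> \<alpha> e' = \<Phi> \<alpha> e} \<Longrightarrow> y \<in> {e' \<in> E. \<Phi> \<alpha> e' = \<Phi> \<alpha> e} \<Longrightarrow> x \<noteq> y \<Longrightarrow> \<eta> \<le> dist x y"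
          using finite_imp_separated[OF fin] by blast
        obtain b where b: "b \<in> B" "e \<in> b" "b \<subseteq> ball e (\<eta>/2)"
          using topological_basisE[OF B(2) open_ball, of e e "\<eta>/2"] \<eta>(1) by auto
        have "closure b \<subseteq> cball e (\<eta>/2)"
          using b(3) ball_subset_cball by (intro closure_minimal) auto
        then have "e' = e" if "e' \<in> E \<inter> closure b" "\<Phi> \<alpha> e' = \<Phi> \<alpha> e" for e'
          using \<eta>(2)[of e e'] \<eta>(1) that e by (cases "e' = e") auto
        then have "e \<in> U b \<alpha>" using e b(2) closure_subset by (auto simp: U_def)
        then show False using no b(1) by blast
      qed
      then show "\<beta> \<in> {\<beta>. infinite {e \<in> E. \<Phi> \<alpha> e = \<beta>}} \<union> (\<Union>b\<in>B. \<Phi> \<alpha> ` U b \<alpha>)"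
        unfolding \<beta> by blast
    qed
    then show "negligible (\<Phi> \<alpha> ` E)" using inf un by (meson negligible_Un negligible_subset)
  qed
qed

text \<open>
  The slice of the Favard set over \<open>\<alpha>\<close> is contained in \<open>\<Phi> \<alpha> ` E\<close>.
\<close>

theorem negligible_favard_set_graph:
  assumes E: "compact E" "hausdorff1 E < \<infinity>" "purely_unrectifiable E"
    and C: "compact C" "\<And>p. p \<in> C \<Longrightarrow> snd p = \<phi> (fst p)"
  shows "negligible (favard_set C E)"
proof -
  let ?F = "favard_set C E"
  have "compact ?F"
    unfolding favard_set_eq_differences using compact_differences[OF E(1) C(1)] by simp
  then have F: "?F \<in> sets borel" by (rule borel_compact)
  then have F': "?F \<in> sets ((borel :: real measure) \<Otimes>\<^sub>M (borel :: real measure))" by (simp only: borel_prod)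
  have sub: "Pair \<alpha> -` ?F \<subseteq> \<Phi> \<alpha> ` E" for \<alpha>
  proof
    fix \<beta> assume "\<beta> \<in> Pair \<alpha> -` ?F"
    then obtain p where p: "p \<in> C" "(\<alpha>, \<beta>) + p \<in> E" by (auto simp: favard_set_def)
    have "\<Phi> \<alpha> ((\<alpha>, \<beta>) + p) = \<beta>" using C(2)[OF p(1)] by (simp add: \<Phi>_def)
    then show "\<beta> \<in> \<Phi> \<alpha> ` E" using p(2) by (metis imageI)
  qed
  have "AE \<alpha> in lborel. emeasure lborel (Pair \<alpha> -` ?F) = 0"
    using AE_negligible_image[OF E]
  proof (rule eventually_mono)
    fix \<alpha> assume "negligible (\<Phi> \<alpha> ` E)"
    then have "negligible (Pair \<alpha> -` ?F)" using sub negligible_subset by blast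
    then have "Pair \<alpha> -` ?F \<in> null_sets lebesgue" by (simp add: negligible_iff_null_sets)
    moreover have "Pair \<alpha> -` ?F \<in> sets borel" using sets_Pair1[OF F'] .
    ultimately show "emeasure lborel (Pair \<alpha> -` ?F) = 0"
      by (simp add: null_sets_def emeasure_completion)
  qed
  then have "(\<integral>\<^sup>+\<alpha>. emeasure lborel (Pair \<alpha> -` ?F) \<partial>lborel) = (\<integral>\<^sup>+\<alpha>. 0 \<partial>(lborel :: real measure))"
    by (rule nn_integral_cong_AE)
  then have "emeasure (lborel \<Otimes>\<^sub>M lborel) ?F = 0"
    using F' by (subst lborel.emeasure_pair_measure_alt) (auto simp: cong: sets_pair_measure_cong)
  then have "emeasure lborel ?F = 0" by (simp add: lborel_prod)
  then show ?thesis using F by (simp add: negligible_iff_null_sets null_sets_def emeasure_completion)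
qed

end

section \<open>From arcs with bilipschitz tangent to graphs\<close>

lemma favard_set_mono: "C \<subseteq> C' \<Longrightarrow> favard_set C E \<subseteq> favard_set C' E"
  unfolding favard_set_def by auto

lemma favard_set_Un: "favard_set (C \<union> C') E = favard_set C E \<union> favard_set C' E"
  unfolding favard_set_def by auto

lemma dist_swap [simp]: "dist (prod.swap p) (prod.swap q) = dist p q"
  by (simp add: dist_prod_def add.commute)

lemma linear_swap: "linear (prod.swap :: real \<times> real \<Rightarrow> real \<times> real)"
  by (auto simp: linear_iff prod_eq_iff)

lemma favard_set_swap: "favard_set (prod.swap ` C) (prod.swap ` E) = prod.swap ` favard_set C E"
  unfolding favard_set_eq_differences
proof (intro set_eqI iffI)
  fix p assume "p \<in> {e - c |e c. e \<in> prod.swap ` E \<and> c \<in> prod.swap ` C}"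
  then obtain e c where "p = prod.swap e - prod.swap c" "e \<in> E" "c \<in> C" by blast
  moreover have "prod.swap e - prod.swap c = prod.swap (e - c)" for e c :: "real \<times> real" by (simp add: prod_eq_iff)
  ultimately show "p \<in> prod.swap ` {e - c |e c. e \<in> E \<and> c \<in> C}" by blast
next
  fix p assume "p \<in> prod.swap ` {e - c |e c. e \<in> E \<and> c \<in> C}"
  then obtain e c where "p = prod.swap (e - c)" "e \<in> E" "c \<in> C" by blast
  moreover have "prod.swap (e - c) = prod.swap e - prod.swap c" for e c :: "real \<times> real" by (simp add: prod_eq_iff)
  ultimately show "p \<in> {e - c |e c. e \<in> prod.swap ` E \<and> c \<in> prod.swap ` C}" by blast
qed

lemma purely_unrectifiable_swap:
  assumes "purely_unrectifiable E"
  shows "purely_unrectifiable (prod.swap ` E)"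
  unfolding purely_unrectifiable_def
proof (intro allI impI)
  fix f :: "real \<Rightarrow> real \<times> real" assume "\<exists>L. L-lipschitz_on UNIV f"
  then obtain L where L: "L-lipschitz_on UNIV f" by blast
  have "L-lipschitz_on UNIV (prod.swap \<circ> f)" using L by (auto simp: lipschitz_on_def)
  then have "hausdorff1 (E \<inter> range (prod.swap \<circ> f)) = 0"
    using assms unfolding purely_unrectifiable_def by blast
  moreover have "prod.swap ` E \<inter> range f \<subseteq> prod.swap ` (E \<inter> range (prod.swap \<circ> f))"
  proof
    fix p assume "p \<in> prod.swap ` E \<inter> range f"
    then obtain e t where et: "e \<in> E" "p = prod.swap e" "p = f t" by blast
    then have "e = (prod.swap \<circ> f) t" by (metis comp_apply swap_swap)
    then have "e \<in> E \<inter> range (prod.swap \<circ> f)" using et by blast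
    then show "p \<in> prod.swap ` (E \<inter> range (prod.swap \<circ> f))" using et by blast
  qed
  then have "hausdorff1 (prod.swap ` E \<inter> range f) \<le> hausdorff1 (prod.swap ` (E \<inter> range (prod.swap \<circ> f)))"
    by (rule hausdorff1_mono)
  moreover have "hausdorff1 (prod.swap ` (E \<inter> range (prod.swap \<circ> f))) \<le> hausdorff1 (E \<inter> range (prod.swap \<circ> f))"
    by (intro hausdorff1_image_le) simp
  ultimately have "hausdorff1 (prod.swap ` E \<inter> range f) \<le> 0" by simp
  then show "hausdorff1 (prod.swap ` E \<inter> range f) = 0" by simp
qed

text \<open>
  The difference of the slopes is the cross product of the unit vectors \<open>w\<close> and \<open>z\<close> divided by
  \<open>fst w * fst z\<close>, and for unit vectors at distance at most \<open>1\<close> the cross product is comparable to the distance.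
\<close>

lemma slope_difference_bounds:
  fixes w z :: "real \<times> real"
  assumes "norm w = 1" "norm z = 1" and prod: "1/16 \<le> fst w * fst z" and near: "norm (w - z) \<le> 1"
  shows "norm (w - z) / 2 \<le> \<bar>snd w / fst w - snd z / fst z\<bar>"
    and "\<bar>snd w / fst w - snd z / fst z\<bar> \<le> 16 * norm (w - z)"
proof -
  obtain a b p q where w: "w = (a, b)" and z: "z = (p, q)" by (metis surj_pair)
  define n where "n = norm (w - z)"
  define X where "X = b * p - q * a"
  define d where "d = a * p + b * q"
  have w1: "a\<^sup>2 + b\<^sup>2 = 1" and z1: "p\<^sup>2 + q\<^sup>2 = 1" using assms(1,2) by (simp_all add: w z norm_Pair)
  have "n\<^sup>2 = (a - p)\<^sup>2 + (b - q)\<^sup>2" by (simp add: n_def w z norm_Pair)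
  then have n2: "n\<^sup>2 = 2 - 2 * d"
    using w1 z1 by (simp add: d_def power2_eq_square algebra_simps)
  have X2: "X\<^sup>2 = (1 - d) * (1 + d)"
  proof -
    have "X\<^sup>2 + d\<^sup>2 = (a\<^sup>2 + b\<^sup>2) * (p\<^sup>2 + q\<^sup>2)" by (simp add: X_def d_def power2_eq_square algebra_simps)
    then have "X\<^sup>2 + d\<^sup>2 = 1" unfolding w1 z1 by simp
    then show ?thesis by (simp add: power2_eq_square algebra_simps)
  qed
  have n0: "0 \<le> n" by (simp add: n_def)
  have "n\<^sup>2 \<le> 1" using near n0 by (simp add: n_def power_le_one)
  then have d: "1/2 \<le> d" using n2 by simp
  have d1: "d \<le> 1" using n2 zero_le_power2[of n] by linarith
  have "(n / 2)\<^sup>2 \<le> X\<^sup>2"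
  proof -
    have "(1 - d) * (1/2) \<le> (1 - d) * (1 + d)" using d d1 by (intro mult_left_mono) auto
    then show ?thesis unfolding X2 by (simp add: power_divide n2)
  qed
  then have Xlo: "n / 2 \<le> \<bar>X\<bar>" using n0 by (simp add: abs_le_square_iff[symmetric])
  have "X\<^sup>2 \<le> n\<^sup>2"
  proof -
    have "(1 - d) * (1 + d) \<le> (1 - d) * 2" using d d1 by (intro mult_left_mono) auto
    then show ?thesis unfolding X2 n2 by simp
  qed
  then have Xhi: "\<bar>X\<bar> \<le> n" using n0 by (simp add: abs_le_square_iff[symmetric])
  have pr: "1/16 \<le> a * p" using prod by (simp add: w z)
  have a1: "\<bar>a\<bar> \<le> 1" "\<bar>p\<bar> \<le> 1"
    using w1 z1 zero_le_power2[of b] zero_le_power2[of q] by (simp_all add: abs_square_le_1[symmetric], linarith+)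
  have pr1: "a * p \<le> 1" using mult_mono[OF a1] abs_le_D1[of "a * p" 1] by (simp add: abs_mult)
  have "a \<noteq> 0" "p \<noteq> 0" using pr by auto
  then have "b / a - q / p = X / (a * p)" by (simp add: X_def field_simps)
  then have eq: "\<bar>snd w / fst w - snd z / fst z\<bar> = \<bar>X\<bar> / (a * p)"
    using pr by (simp add: w z abs_divide)
  have "\<bar>X\<bar> \<le> \<bar>X\<bar> / (a * p)" using pr pr1 by (simp add: le_divide_eq mult_left_le)
  then show "norm (w - z) / 2 \<le> \<bar>snd w / fst w - snd z / fst z\<bar>" using Xlo unfolding eq n_def by linarith
  have "\<bar>X\<bar> / (a * p) \<le> \<bar>X\<bar> / (1/16)" using pr by (intro divide_left_mono) auto
  then have "\<bar>X\<bar> / (a * p) \<le> 16 * \<bar>X\<bar>" by simp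
  then show "\<bar>snd w / fst w - snd z / fst z\<bar> \<le> 16 * norm (w - z)" using Xhi unfolding eq n_def by linarith
qed

text \<open>
  Outside \<open>[a, b]\<close> the function \<open>\<psi>0\<close> is continued affinely with slope \<open>\<sigma>\<close>. Hence the bounds \<open>c \<le> 1 \<le> K\<close>.
\<close>

lemma antiderivative_of_bilipschitz_extension:
  fixes \<psi>0 :: "real \<Rightarrow> real"
  assumes ab: "a \<le> b" and c: "0 < c" "c \<le> 1" "1 \<le> K" and \<sigma>: "\<bar>\<sigma>\<bar> = 1"
    and lower: "\<And>s t. a \<le> s \<Longrightarrow> s \<le> t \<Longrightarrow> t \<le> b \<Longrightarrow> c * (t - s) \<le> \<sigma> * (\<psi>0 t - \<psi>0 s)"
    and upper: "\<And>s t. a \<le> s \<Longrightarrow> s \<le> t \<Longrightarrow> t \<le> b \<Longrightarrow> \<sigma> * (\<psi>0 t - \<psi>0 s) \<le> K * (t - s)"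
  shows "\<exists>\<phi> \<psi>. curved_projections \<phi> \<psi> \<sigma> c K \<and> (\<forall>t\<in>{a..b}. \<psi> t = \<psi>0 t)"
proof -
  define k where "k t = max a (min b t)" for t
  have k: "a \<le> k t" "k t \<le> b" for t using ab by (auto simp: k_def)
  have km: "k s \<le> k t" "k t - k s \<le> t - s" if "s \<le> t" for s t using that by (auto simp: k_def max_def min_def)
  define \<psi> where "\<psi> t = \<psi>0 (k t) + \<sigma> * (t - k t)" for t
  have \<sigma>2: "\<sigma> * \<sigma> = 1" using \<sigma> by (metis abs_mult_self_eq mult_1)
  have diff: "\<sigma> * (\<psi> t - \<psi> s) = \<sigma> * (\<psi>0 (k t) - \<psi>0 (k s)) + ((t - s) - (k t - k s))" for s t
  proof -
    have "\<sigma> * (\<psi> t - \<psi> s) = \<sigma> * (\<psi>0 (k t) - \<psi>0 (k s)) + \<sigma> * \<sigma> * ((t - s) - (k t - k s))"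
      unfolding \<psi>_def by (simp add: algebra_simps)
    then show ?thesis unfolding \<sigma>2 by simp
  qed
  have lo: "c * (t - s) \<le> \<sigma> * (\<psi> t - \<psi> s)" if "s \<le> t" for s t
  proof -
    have "c * ((t - s) - (k t - k s)) \<le> 1 * ((t - s) - (k t - k s))"
      using km[OF that] c by (intro mult_right_mono) auto
    then show ?thesis using lower[of "k s" "k t"] k km[OF that] unfolding diff by (simp add: algebra_simps)
  qed
  have hi: "\<sigma> * (\<psi> t - \<psi> s) \<le> K * (t - s)" if "s \<le> t" for s t
  proof -
    have "1 * ((t - s) - (k t - k s)) \<le> K * ((t - s) - (k t - k s))"
      using km[OF that] c by (intro mult_right_mono) auto
    then show ?thesis using upper[of "k s" "k t"] k km[OF that] unfolding diff by (simp add: algebra_simps)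
  qed
  have lip: "\<bar>\<psi> t - \<psi> s\<bar> \<le> K * \<bar>t - s\<bar>" for s t
  proof -
    have *: "\<bar>\<psi> t - \<psi> s\<bar> \<le> K * (t - s)" if "s \<le> t" for s t
    proof -
      have "\<bar>\<psi> t - \<psi> s\<bar> = \<bar>\<sigma> * (\<psi> t - \<psi> s)\<bar>" using \<sigma> by (simp add: abs_mult)
      moreover have "0 \<le> c * (t - s)" using c that by simp
      ultimately show ?thesis using lo[OF that] hi[OF that] by simp
    qed
    show ?thesis using *[of s t] *[of t s] by (cases "s \<le> t") (auto simp: abs_minus_commute)
  qed
  have "K-lipschitz_on UNIV \<psi>"
    using c lip by (intro lipschitz_onI) (auto simp: dist_real_def)
  then have "continuous_on UNIV \<psi>" by (rule lipschitz_on_continuous_on)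
  then have "isCont \<psi> x" for x by (simp add: continuous_on_eq_continuous_at)
  then obtain \<phi> where "\<And>x. (\<phi> has_vector_derivative \<psi> x) (at x)"
    using einterval_antiderivative[of "-\<infinity>" "\<infinity>" \<psi>] by auto
  then have "curved_projections \<phi> \<psi> \<sigma> c K"
    using \<sigma> c lo hi by unfold_locales (auto simp: has_real_derivative_iff_has_vector_derivative)
  moreover have "\<forall>t\<in>{a..b}. \<psi> t = \<psi>0 t" by (auto simp: \<psi>_def k_def min_def max_def)
  ultimately show ?thesis by blast
qed

lemma curved_projections_add_const:
  "curved_projections \<phi> \<psi> \<sigma> c K \<Longrightarrow> curved_projections (\<lambda>t. \<phi> t + d) \<psi> \<sigma> c K"
  unfolding curved_projections_def by (auto intro!: derivative_eq_intros)

text \<open>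
  While the tangent is not too steep, the arc is a graph over the first coordinate. Its slope
  \<open>m = snd \<gamma>' / fst \<gamma>'\<close> is bilipschitz in the arclength, which is in turn bilipschitz in the first
  coordinate. Being injective and continuous, the slope is monotone.
\<close>

lemma short_arc_negligible:
  fixes \<gamma> \<gamma>' :: "real \<Rightarrow> real \<times> real"
  assumes E: "compact E" "hausdorff1 E < \<infinity>" "purely_unrectifiable E"
    and pq: "p < q" and Lam: "1 \<le> \<Lambda>" "\<Lambda> * (q - p) \<le> 1/4"
    and der: "\<And>s. s \<in> {p..q} \<Longrightarrow> (\<gamma> has_vector_derivative \<gamma>' s) (at s within {p..q})"
    and unit: "\<And>s. s \<in> {p..q} \<Longrightarrow> norm (\<gamma>' s) = 1"
    and lo: "\<And>s t. s \<in> {p..q} \<Longrightarrow> t \<in> {p..q} \<Longrightarrow> inverse \<Lambda> * \<bar>s - t\<bar> \<le> norm (\<gamma>' s - \<gamma>' t)"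
    and hi: "\<And>s t. s \<in> {p..q} \<Longrightarrow> t \<in> {p..q} \<Longrightarrow> norm (\<gamma>' s - \<gamma>' t) \<le> \<Lambda> * \<bar>s - t\<bar>"
    and start: "1/2 \<le> \<bar>fst (\<gamma>' p)\<bar>"
  shows "negligible (favard_set (\<gamma> ` {p..q}) E)"
proof -
  define x where "x s = fst (\<gamma> s)" for s
  define y where "y s = snd (\<gamma> s)" for s
  define m where "m s = snd (\<gamma>' s) / fst (\<gamma>' s)" for s
  have xder: "(x has_real_derivative fst (\<gamma>' s)) (at s within {p..q})" if "s \<in> {p..q}" for s
    unfolding x_def has_real_derivative_iff_has_vector_derivative
    using bounded_linear.has_vector_derivative[OF bounded_linear_fst der[OF that]] .
  have yder: "(y has_real_derivative snd (\<gamma>' s)) (at s within {p..q})" if "s \<in> {p..q}" for s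
    unfolding y_def has_real_derivative_iff_has_vector_derivative
    using bounded_linear.has_vector_derivative[OF bounded_linear_snd der[OF that]] .
  define \<tau> where "\<tau> = sgn (fst (\<gamma>' p))"
  have \<tau>: "\<bar>\<tau>\<bar> = 1" "\<tau> * \<tau> = 1" "1/2 \<le> \<tau> * fst (\<gamma>' p)" using start by (auto simp: \<tau>_def sgn_if split: if_splits)
  have short: "\<Lambda> * \<bar>s - t\<bar> \<le> 1/4" if "s \<in> {p..q}" "t \<in> {p..q}" for s t
  proof -
    have "\<Lambda> * \<bar>s - t\<bar> \<le> \<Lambda> * (q - p)" using that Lam by (intro mult_left_mono) auto
    then show ?thesis using Lam(2) by linarith
  qed
  have x'lo: "1/4 \<le> \<tau> * fst (\<gamma>' s)" if s: "s \<in> {p..q}" for s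
  proof -
    have "\<bar>fst (\<gamma>' s) - fst (\<gamma>' p)\<bar> \<le> norm (\<gamma>' s - \<gamma>' p)"
      using dist_fst_le[of "\<gamma>' s" "\<gamma>' p"] by (simp add: dist_norm)
    also have "\<dots> \<le> 1/4" using hi[OF s, of p] short[OF s, of p] pq by force
    finally have "\<bar>\<tau> * (fst (\<gamma>' s) - fst (\<gamma>' p))\<bar> \<le> 1/4" using \<tau>(1) by (simp add: abs_mult)
    then have "\<bar>\<tau> * fst (\<gamma>' s) - \<tau> * fst (\<gamma>' p)\<bar> \<le> 1/4" by (simp only: right_diff_distrib)
    then show ?thesis using \<tau>(3) unfolding abs_le_iff by linarith
  qed
  have x'hi: "\<tau> * fst (\<gamma>' s) \<le> 1" if s: "s \<in> {p..q}" for s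
  proof -
    have "\<bar>fst (\<gamma>' s)\<bar> \<le> 1" using norm_fst_le[of "fst (\<gamma>' s)" "snd (\<gamma>' s)"] unit[OF s] by simp
    then have "\<bar>\<tau> * fst (\<gamma>' s)\<bar> \<le> 1" using \<tau>(1) by (simp add: abs_mult)
    then show ?thesis by simp
  qed
  have m: "inverse (2 * \<Lambda>) * \<bar>s - t\<bar> \<le> \<bar>m s - m t\<bar>" "\<bar>m s - m t\<bar> \<le> 16 * \<Lambda> * \<bar>s - t\<bar>"
    if s: "s \<in> {p..q}" and t: "t \<in> {p..q}" for s t
  proof -
    have "1/16 \<le> (\<tau> * fst (\<gamma>' s)) * (\<tau> * fst (\<gamma>' t))"
      using mult_mono[OF x'lo[OF s] x'lo[OF t]] x'lo[OF s] by simp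
    also have "\<dots> = (\<tau> * \<tau>) * (fst (\<gamma>' s) * fst (\<gamma>' t))" by (simp add: mult_ac)
    finally have pr: "1/16 \<le> fst (\<gamma>' s) * fst (\<gamma>' t)" unfolding \<tau>(2) by simp
    have n1: "norm (\<gamma>' s - \<gamma>' t) \<le> 1" using hi[OF s t] short[OF s t] by linarith
    note b = slope_difference_bounds[OF unit[OF s] unit[OF t] pr n1]
    show "inverse (2 * \<Lambda>) * \<bar>s - t\<bar> \<le> \<bar>m s - m t\<bar>"
      using b(1) lo[OF s t] by (simp add: m_def)
    show "\<bar>m s - m t\<bar> \<le> 16 * \<Lambda> * \<bar>s - t\<bar>"
      using b(2) hi[OF s t] by (simp add: m_def)
  qed
  have xmono: "(t - s) / 4 \<le> \<tau> * (x t - x s)" "\<tau> * (x t - x s) \<le> t - s" if st: "p \<le> s" "s \<le> t" "t \<le> q" for s t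
  proof -
    have "(t - s) / 4 \<le> \<tau> * (x t - x s) \<and> \<tau> * (x t - x s) \<le> t - s"
    proof (cases "s = t")
      case False
      have "\<exists>z\<in>{s<..<t}. x t - x s = (\<lambda>h. fst (\<gamma>' z) * h) (t - s)"
      proof (rule mvt_simple)
        show "s < t" using False st by simp
        fix z assume "s \<le> z" "z \<le> t"
        then have z: "z \<in> {p..q}" using st by auto
        have "(x has_real_derivative fst (\<gamma>' z)) (at z within {s..t})"
          by (rule has_field_derivative_subset[OF xder[OF z]]) (use st in auto)
        then show "(x has_derivative (\<lambda>h. fst (\<gamma>' z) * h)) (at z within {s..t})"
          by (simp add: has_field_derivative_def)
      qed
      then obtain z where "s < z" "z < t" and xz: "x t - x s = fst (\<gamma>' z) * (t - s)" by auto
      then have z: "z \<in> {p..q}" using st by simp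
      have eq: "\<tau> * (x t - x s) = (\<tau> * fst (\<gamma>' z)) * (t - s)" unfolding xz by simp
      have "1/4 * (t - s) \<le> \<tau> * (x t - x s)" unfolding eq using x'lo[OF z] st by (intro mult_right_mono) auto
      moreover have "\<tau> * (x t - x s) \<le> 1 * (t - s)" unfolding eq using x'hi[OF z] st by (intro mult_right_mono) auto
      ultimately show ?thesis by simp
    qed simp
    then show "(t - s) / 4 \<le> \<tau> * (x t - x s)" "\<tau> * (x t - x s) \<le> t - s" by auto
  qed
  have mlip: "(16 * \<Lambda>)-lipschitz_on {p..q} m"
    using m(2) Lam by (intro lipschitz_onI) (auto simp: dist_real_def)
  have mcont: "continuous_on {p..q} m" using mlip by (rule lipschitz_on_continuous_on)
  have minj: "inj_on m {p..q}"
  proof (rule inj_onI, rule ccontr)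
    fix s t assume st: "s \<in> {p..q}" "t \<in> {p..q}" "m s = m t" "s \<noteq> t"
    have "0 < inverse (2 * \<Lambda>) * \<bar>s - t\<bar>" using Lam st by simp
    then show False using m(1)[OF st(1,2)] st(3) by simp
  qed
  have "strict_mono_on {p..q} m \<or> strict_antimono_on {p..q} m"
    using injective_eq_monotone_map[OF _ mcont] minj by (simp add: is_interval_cc)
  then obtain \<sigma> :: real where \<sigma>: "\<bar>\<sigma>\<bar> = 1" "\<And>s t. p \<le> s \<Longrightarrow> s \<le> t \<Longrightarrow> t \<le> q \<Longrightarrow> 0 \<le> \<sigma> * (m t - m s)"
  proof
    assume a: "strict_mono_on {p..q} m"
    show ?thesis
    proof (rule that[of 1])
      fix s t assume "p \<le> s" "s \<le> t" "t \<le> q"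
      then show "0 \<le> 1 * (m t - m s)" using strict_mono_onD[OF a, of s t] by (cases "s = t") auto
    qed simp
  next
    assume a: "strict_antimono_on {p..q} m"
    show ?thesis
    proof (rule that[of "-1"])
      fix s t assume "p \<le> s" "s \<le> t" "t \<le> q"
      then show "0 \<le> - 1 * (m t - m s)" using monotone_onD[OF a, of s t] by (cases "s = t") auto
    qed simp
  qed
  have mmono: "inverse (2 * \<Lambda>) * (t - s) \<le> \<sigma> * (m t - m s)" "\<sigma> * (m t - m s) \<le> 16 * \<Lambda> * (t - s)"
    if st: "p \<le> s" "s \<le> t" "t \<le> q" for s t
  proof -
    have "\<sigma> * (m t - m s) = \<bar>\<sigma> * (m t - m s)\<bar>" using \<sigma>(2)[OF st] by simp
    also have "\<dots> = \<bar>m t - m s\<bar>" using \<sigma>(1) by (simp add: abs_mult)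
    finally have e: "\<sigma> * (m t - m s) = \<bar>m t - m s\<bar>" .
    show "inverse (2 * \<Lambda>) * (t - s) \<le> \<sigma> * (m t - m s)" "\<sigma> * (m t - m s) \<le> 16 * \<Lambda> * (t - s)"
      unfolding e using m[of t s] st by auto
  qed
  have xcont: "continuous_on {p..q} x"
    using xder by (meson DERIV_continuous continuous_on_eq_continuous_within)
  obtain u0 u1 where X: "x ` {p..q} = {u0..u1}" "u0 \<le> u1"
    using continuous_image_closed_interval[OF less_imp_le[OF pq] xcont] by blast
  \<comment> \<open>The slope of the arc as a function of the first coordinate.\<close>
  define \<psi>0 where "\<psi>0 u = m (inv_into {p..q} x u)" for u
  have xinj: "inj_on x {p..q}"
  proof (rule inj_onI, rule ccontr)
    fix s t assume st: "s \<in> {p..q}" "t \<in> {p..q}" "x s = x t" "s \<noteq> t"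
    then show False using xmono(1)[of s t] xmono(1)[of t s] by (cases "s \<le> t") auto
  qed
  have \<psi>0x: "\<psi>0 (x s) = m s" if "s \<in> {p..q}" for s using xinj that by (simp add: \<psi>0_def)
  define c where "c = inverse (2 * \<Lambda>)"
  have c: "0 < c" "c \<le> 1" using Lam le_imp_inverse_le[of 1 "2 * \<Lambda>"] by (simp_all only: c_def inverse_1) auto
  have main: "c * (v - u) \<le> (\<sigma> * \<tau>) * (\<psi>0 v - \<psi>0 u) \<and> (\<sigma> * \<tau>) * (\<psi>0 v - \<psi>0 u) \<le> 64 * \<Lambda> * (v - u)"
    if uv: "u0 \<le> u" "u \<le> v" "v \<le> u1" for u v
  proof -
    have "u \<in> x ` {p..q}" "v \<in> x ` {p..q}" unfolding X(1) using uv by auto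
    then obtain s t where st: "s \<in> {p..q}" "t \<in> {p..q}" "u = x s" "v = x t" by blast
    have key: "c * (\<tau> * (x t' - x s')) \<le> \<sigma> * (m t' - m s') \<and> \<sigma> * (m t' - m s') \<le> 64 * \<Lambda> * (\<tau> * (x t' - x s'))"
      if "p \<le> s'" "s' \<le> t'" "t' \<le> q" for s' t'
    proof
      have "c * (\<tau> * (x t' - x s')) \<le> c * (t' - s')" using xmono(2)[OF that] c by (intro mult_left_mono) auto
      then show "c * (\<tau> * (x t' - x s')) \<le> \<sigma> * (m t' - m s')" using mmono(1)[OF that] by (simp add: c_def)
      have "64 * \<Lambda> * ((t' - s') / 4) \<le> 64 * \<Lambda> * (\<tau> * (x t' - x s'))"
        using xmono(1)[OF that] Lam by (intro mult_left_mono) auto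
      then show "\<sigma> * (m t' - m s') \<le> 64 * \<Lambda> * (\<tau> * (x t' - x s'))" using mmono(2)[OF that] by simp
    qed
    have "\<tau> = 1 \<or> \<tau> = -1" using \<tau>(1) by linarith
    then show ?thesis
    proof
      assume t1: "\<tau> = 1"
      show ?thesis
      proof (cases "s \<le> t")
        case True
        then show ?thesis using key[of s t] st t1 by (simp add: \<psi>0x)
      next
        case False
        then have "x t < x s" using xmono(1)[of t s] st t1 by simp
        then show ?thesis using st uv by simp
      qed
    next
      assume t1: "\<tau> = -1"
      show ?thesis
      proof (cases "t \<le> s")
        case True
        have flip: "(\<sigma> * \<tau>) * (\<psi>0 v - \<psi>0 u) = \<sigma> * (m s - m t)" "v - u = \<tau> * (x s - x t)"
          using st t1 by (simp_all add: \<psi>0x algebra_simps)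
        show ?thesis unfolding flip by (rule key) (use True st in auto)
      next
        case False
        then have "x t < x s" using xmono(1)[of s t] st t1 by simp
        then show ?thesis using st uv by simp
      qed
    qed
  qed
  have "\<bar>\<sigma> * \<tau>\<bar> = 1" using \<sigma>(1) \<tau>(1) by (simp add: abs_mult)
  then obtain \<phi>0 \<psi> where \<phi>0: "curved_projections \<phi>0 \<psi> (\<sigma> * \<tau>) c (64 * \<Lambda>)" "\<And>u. u \<in> {u0..u1} \<Longrightarrow> \<psi> u = \<psi>0 u"
    using antiderivative_of_bilipschitz_extension[of u0 u1 c "64 * \<Lambda>" "\<sigma> * \<tau>" \<psi>0] X(2) c Lam main by auto
  have \<phi>0der: "(\<phi>0 has_real_derivative \<psi> u) (at u)" for u using \<phi>0(1) by (rule curved_projections.deriv)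
  \<comment> \<open>By the choice of \<open>\<psi>0\<close>, the graph of \<open>\<phi>0\<close> has the same tangents as the arc, so the two differ by a
    vertical translation.\<close>
  have "\<exists>d. \<forall>s\<in>{p..q}. y s - \<phi>0 (x s) = d"
  proof (rule has_field_derivative_zero_constant)
    fix s assume s: "s \<in> {p..q}"
    have "x s \<in> {u0..u1}" using X(1) s by blast
    then have "\<psi> (x s) = m s" using \<phi>0(2) \<psi>0x[OF s] by simp
    moreover have "fst (\<gamma>' s) \<noteq> 0" using x'lo[OF s] by auto
    ultimately have e: "\<psi> (x s) * fst (\<gamma>' s) = snd (\<gamma>' s)" by (simp add: m_def)
    have "((\<lambda>s. \<phi>0 (x s)) has_real_derivative \<psi> (x s) * fst (\<gamma>' s)) (at s within {p..q})"
      by (rule DERIV_chain2[OF \<phi>0der xder[OF s]])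
    from DERIV_diff[OF yder[OF s] this] show "((\<lambda>s. y s - \<phi>0 (x s)) has_real_derivative 0) (at s within {p..q})"
      by (simp add: e)
  qed simp
  then obtain d where d: "\<And>s. s \<in> {p..q} \<Longrightarrow> y s = \<phi>0 (x s) + d" by (metis add.commute diff_add_cancel)
  interpret curved_projections "\<lambda>t. \<phi>0 t + d" \<psi> "\<sigma> * \<tau>" c "64 * \<Lambda>"
    by (rule curved_projections_add_const[OF \<phi>0(1)])
  show ?thesis
  proof (rule negligible_favard_set_graph[OF E])
    have "continuous_on {p..q} \<gamma>"
      using der by (meson continuous_on_eq_continuous_within has_vector_derivative_continuous)
    then show "compact (\<gamma> ` {p..q})" by (intro compact_continuous_image) auto
    fix e assume "e \<in> \<gamma> ` {p..q}"
    then show "snd e = \<phi>0 (fst e) + d" using d by (auto simp: x_def y_def)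
  qed
qed

text \<open>
  A unit vector has a coordinate of absolute value at least \<open>1/2\<close>. If it is the second one, the
  coordinates are exchanged.
\<close>

lemma short_arc_negligible_any_direction:
  fixes \<gamma> \<gamma>' :: "real \<Rightarrow> real \<times> real"
  assumes E: "compact E" "hausdorff1 E < \<infinity>" "purely_unrectifiable E"
    and pq: "p < q" and Lam: "1 \<le> \<Lambda>" "\<Lambda> * (q - p) \<le> 1/4"
    and der: "\<And>s. s \<in> {p..q} \<Longrightarrow> (\<gamma> has_vector_derivative \<gamma>' s) (at s within {p..q})"
    and unit: "\<And>s. s \<in> {p..q} \<Longrightarrow> norm (\<gamma>' s) = 1"
    and lo: "\<And>s t. s \<in> {p..q} \<Longrightarrow> t \<in> {p..q} \<Longrightarrow> inverse \<Lambda> * \<bar>s - t\<bar> \<le> norm (\<gamma>' s - \<gamma>' t)"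
    and hi: "\<And>s t. s \<in> {p..q} \<Longrightarrow> t \<in> {p..q} \<Longrightarrow> norm (\<gamma>' s - \<gamma>' t) \<le> \<Lambda> * \<bar>s - t\<bar>"
  shows "negligible (favard_set (\<gamma> ` {p..q}) E)"
proof (cases "1/2 \<le> \<bar>fst (\<gamma>' p)\<bar>")
  case True
  show ?thesis by (rule short_arc_negligible[OF E pq Lam der unit lo hi True])
next
  case False
  have "(fst (\<gamma>' p))\<^sup>2 + (snd (\<gamma>' p))\<^sup>2 = 1"
    using unit[of p] pq norm_Pair[of "fst (\<gamma>' p)" "snd (\<gamma>' p)"] by simp
  moreover have "(fst (\<gamma>' p))\<^sup>2 \<le> (1/2)\<^sup>2" using False by (intro power2_le_iff_abs_le[THEN iffD2]) auto
  ultimately have "(1/2)\<^sup>2 \<le> (snd (\<gamma>' p))\<^sup>2" by (simp add: power2_eq_square)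
  then have start: "1/2 \<le> \<bar>fst (prod.swap (\<gamma>' p))\<bar>" by (simp add: abs_le_square_iff[symmetric])
  have nsw: "norm (prod.swap u) = norm u" "prod.swap u - prod.swap v = prod.swap (u - v)" for u v :: "real \<times> real"
    by (simp_all add: norm_prod_def add.commute prod_eq_iff)
  have blsw: "bounded_linear (prod.swap :: real \<times> real \<Rightarrow> real \<times> real)"
    using linear_swap linear_conv_bounded_linear by blast
  have "hausdorff1 (prod.swap ` E) \<le> hausdorff1 E" by (intro hausdorff1_image_le) simp
  then have H: "hausdorff1 (prod.swap ` E) < \<infinity>" using E(2) by auto
  have Ec: "compact (prod.swap ` E)"
    using E(1) blsw by (intro compact_continuous_image linear_continuous_on)
  have "negligible (favard_set ((\<lambda>s. prod.swap (\<gamma> s)) ` {p..q}) (prod.swap ` E))"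
    by (rule short_arc_negligible[OF Ec H purely_unrectifiable_swap[OF E(3)] pq Lam
        bounded_linear.has_vector_derivative[OF blsw der] _ _ _ start])
      (use unit lo hi in \<open>auto simp: nsw\<close>)
  then have "negligible (prod.swap ` favard_set (\<gamma> ` {p..q}) E)"
    by (simp add: favard_set_swap[symmetric] image_image)
  then have "negligible (prod.swap ` prod.swap ` favard_set (\<gamma> ` {p..q}) E)"
    by (rule negligible_differentiable_image_negligible[OF order_refl _ linear_imp_differentiable_on[OF linear_swap]])
  then show ?thesis by (simp add: image_image)
qed

text \<open>
  Bisection of the parameter interval reduces an arc to arcs that are short compared with \<open>1 / \<Lambda>\<close>.
\<close>

lemma arc_negligible:
  assumes E: "compact E" "hausdorff1 E < \<infinity>" "purely_unrectifiable E"
    and arc: "bilipschitz_tangent_arc \<gamma> a b"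
  shows "negligible (favard_set (\<gamma> ` {a..b}) E)"
proof -
  obtain \<gamma>' \<Lambda> where ab: "a < b" and der: "\<And>s. s \<in> {a..b} \<Longrightarrow> (\<gamma> has_vector_derivative \<gamma>' s) (at s within {a..b})"
    and unit: "\<And>s. s \<in> {a..b} \<Longrightarrow> norm (\<gamma>' s) = 1" and Lam: "1 \<le> \<Lambda>"
    and lo: "\<And>s t. s \<in> {a..b} \<Longrightarrow> t \<in> {a..b} \<Longrightarrow> inverse \<Lambda> * \<bar>s - t\<bar> \<le> norm (\<gamma>' s - \<gamma>' t)"
    and hi: "\<And>s t. s \<in> {a..b} \<Longrightarrow> t \<in> {a..b} \<Longrightarrow> norm (\<gamma>' s - \<gamma>' t) \<le> \<Lambda> * \<bar>s - t\<bar>"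
    using arc unfolding bilipschitz_tangent_arc_def by blast
  have "negligible (favard_set (\<gamma> ` ({a..b} \<inter> {a..b})) E)" using less_imp_le[OF ab]
  proof (induction a b rule: Bolzano[where P = "\<lambda>s t. negligible (favard_set (\<gamma> ` ({s..t} \<inter> {a..b})) E)", consumes 1])
    case (trans r s t)
    have "{r..t} = {r..s} \<union> {s..t}" using trans by auto
    then have "\<gamma> ` ({r..t} \<inter> {a..b}) = \<gamma> ` ({r..s} \<inter> {a..b}) \<union> \<gamma> ` ({s..t} \<inter> {a..b})" by auto
    then show ?case using trans by (simp add: favard_set_Un)
  next
    case (local z)
    define \<delta> where "\<delta> = 1 / (8 * \<Lambda>)"
    have \<delta>: "0 < \<delta>" using Lam by (simp add: \<delta>_def)
    define p where "p = max a (z - \<delta>)"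
    define q where "q = min b (z + \<delta>)"
    have pq: "p < q" "{p..q} \<subseteq> {a..b}" "q - p \<le> 2 * \<delta>" using local ab \<delta> by (auto simp: p_def q_def)
    have "\<Lambda> * (q - p) \<le> \<Lambda> * (2 * \<delta>)" using pq Lam by (intro mult_left_mono) auto
    then have L2: "\<Lambda> * (q - p) \<le> 1/4" using Lam by (simp add: \<delta>_def)
    have neg: "negligible (favard_set (\<gamma> ` {p..q}) E)"
      by (rule short_arc_negligible_any_direction[OF E pq(1) Lam L2, of \<gamma> \<gamma>'])
        (use pq(2) unit lo hi has_vector_derivative_within_subset[OF der pq(2)] in auto)
    have "negligible (favard_set (\<gamma> ` ({s..t} \<inter> {a..b})) E)" if "s \<le> z \<and> z \<le> t \<and> t - s < \<delta>" for s t
    proof (rule negligible_subset[OF neg favard_set_mono])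
      show "\<gamma> ` ({s..t} \<inter> {a..b}) \<subseteq> \<gamma> ` {p..q}" using that by (intro image_mono) (auto simp: p_def q_def)
    qed
    then show ?case using \<delta> by blast
  qed
  then show ?thesis by simp
qed

theorem theorem1p7:
  fixes E C :: "(real \<times> real) set"
  assumes "E \<subseteq> {0..1} \<times> {0..1}"
    and "compact E"
    and "hausdorff1 E < \<infinity>"
    and "purely_unrectifiable E"
    and "piecewise_bilipschitz_tangent_curve C"
  shows "favard_curve_length C E = 0"
proof -
  obtain n :: nat and \<tau> :: "nat \<Rightarrow> real" and \<gamma>
    where arc: "\<And>i. i < n \<Longrightarrow> bilipschitz_tangent_arc \<gamma> (\<tau> i) (\<tau> (Suc i))"
      and C: "C = (\<Union>i<n. \<gamma> ` {\<tau> i..\<tau> (Suc i)})"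
    using assms(5) unfolding piecewise_bilipschitz_tangent_curve_def by blast
  have "favard_set C E = (\<Union>i<n. favard_set (\<gamma> ` {\<tau> i..\<tau> (Suc i)}) E)"
    unfolding C favard_set_def by auto
  moreover have "negligible (\<Union>i<n. favard_set (\<gamma> ` {\<tau> i..\<tau> (Suc i)}) E)"
    using arc_negligible[OF assms(2-4) arc] by (intro negligible_Union) auto
  ultimately have "favard_set C E \<in> null_sets lebesgue" by (simp add: negligible_iff_null_sets)
  then show ?thesis unfolding favard_curve_length_def by auto
qed

end
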